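(* Let $\mathcal{H}$ be a Hopf algebra with bijective antipode over a field $k$ of characteristic zero, let $B$ be any left $\mathcal{H}$-algebra and let $A$ be a Yetter-Drinfeld $\mathcal{H}$-algebra. Then $A\otimes B$, with multiplication $$(a\otimes b)(c\otimes d)=ac_{<0>}\otimes(c_{<1>}\cdot b)d$$ and diagonal $\mathcal{H}$-action $$h\cdot(a\otimes b)=h^{(0)}\cdot a\otimes h^{(1)}\cdot b,$$ is a left $\mathcal{H}$-algebra.
   Context: Sweedler notation: $\Delta h=h^{(0)}\otimes h^{(1)}$; $S,\epsilon$ are antipode and counit. Algebras are associative and unital. A left $\mathcal{H}$-algebra is an algebra $A$ that is a left $\mathcal{H}$-module with $h\cdot(ab)=(h^{(0)}\cdot a)(h^{(1)}\cdot b)$, $h\cdot1=\epsilon(h)1$. A Yetter-Drinfeld $\mathcal{H}$-algebra is an algebra $A$ that is (1) a left $\mathcal{H}$-algebra; (2) a right $\mathcal{H}^{op}$-comodule algebra, i.e. there is a right coaction $\rho:A\to A\otimes\mathcal{H}$, $\rho(a)=a_{<0>}\otimes a_{<1>}$, with $\rho(ab)=a_{<0>}b_{<0>}\otimes b_{<1>}a_{<1>}$ and $\rho(1)=1\otimes1$; (3) satisfying $(h^{(1)}\cdot a)_{<0>}\otimes(h^{(1)}\cdot a)_{<1>}h^{(0)}=h^{(0)}\cdot a_{<0>}\otimes h^{(1)}a_{<1>}$ for all $h\in\mathcal{H}$, $a\in A$. *)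

theory Defs
  imports "HOL-Algebra.Module" "HOL-Algebra.AbelCoset"
begin

section \<open>Tensor products over a commutative ring\<close>

text \<open>
  Elements of the free module on \<open>S\<close> are finitely supported functions vanishing outside \<open>S\<close>.
  Only the module part of the records \<open>free_mod\<close> and \<open>tensor_mod\<close> is meaningful.
\<close>

definition free_mod :: "('k, 'x) ring_scheme \<Rightarrow> 'i set \<Rightarrow> ('k, 'i \<Rightarrow> 'k) module" where
  "free_mod K S =
    \<lparr>carrier = {f. (\<forall>i. f i \<in> carrier K) \<and> finite {i. f i \<noteq> \<zero>\<^bsub>K\<^esub>} \<and> (\<forall>i. i \<notin> S \<longrightarrow> f i = \<zero>\<^bsub>K\<^esub>)},
     mult = (\<lambda>_ _. undefined),
     one = undefined,
     zero = (\<lambda>_. \<zero>\<^bsub>K\<^esub>),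
     add = (\<lambda>f g i. f i \<oplus>\<^bsub>K\<^esub> g i),
     smult = (\<lambda>c f i. c \<otimes>\<^bsub>K\<^esub> f i)\<rparr>"

definition free_gen :: "('k, 'x) ring_scheme \<Rightarrow> 'i \<Rightarrow> 'i \<Rightarrow> 'k" where
  "free_gen K i = (\<lambda>j. if j = i then \<one>\<^bsub>K\<^esub> else \<zero>\<^bsub>K\<^esub>)"

abbreviation free_pairs ::
  "('k, 'x) ring_scheme \<Rightarrow> ('k, 'a, 'y) module_scheme \<Rightarrow> ('k, 'b, 'z) module_scheme
    \<Rightarrow> ('k, 'a \<times> 'b \<Rightarrow> 'k) module" where
  "free_pairs K M N \<equiv> free_mod K (carrier M \<times> carrier N)"

definition bilinear_relators ::
  "('k, 'x) ring_scheme \<Rightarrow> ('k, 'a, 'y) module_scheme \<Rightarrow> ('k, 'b, 'z) module_scheme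
    \<Rightarrow> ('a \<times> 'b \<Rightarrow> 'k) set" where
  "bilinear_relators K M N = (let F = free_pairs K M N; e = free_gen K in
     {e (m \<oplus>\<^bsub>M\<^esub> m', n) \<ominus>\<^bsub>F\<^esub> (e (m, n) \<oplus>\<^bsub>F\<^esub> e (m', n)) | m m' n.
        m \<in> carrier M \<and> m' \<in> carrier M \<and> n \<in> carrier N} \<union>
     {e (m, n \<oplus>\<^bsub>N\<^esub> n') \<ominus>\<^bsub>F\<^esub> (e (m, n) \<oplus>\<^bsub>F\<^esub> e (m, n')) | m n n'.
        m \<in> carrier M \<and> n \<in> carrier N \<and> n' \<in> carrier N} \<union>
     {e (c \<odot>\<^bsub>M\<^esub> m, n) \<ominus>\<^bsub>F\<^esub> c \<odot>\<^bsub>F\<^esub> e (m, n) | c m n.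
        c \<in> carrier K \<and> m \<in> carrier M \<and> n \<in> carrier N} \<union>
     {e (m, c \<odot>\<^bsub>N\<^esub> n) \<ominus>\<^bsub>F\<^esub> c \<odot>\<^bsub>F\<^esub> e (m, n) | c m n.
        c \<in> carrier K \<and> m \<in> carrier M \<and> n \<in> carrier N})"

definition tensor_rel ::
  "('k, 'x) ring_scheme \<Rightarrow> ('k, 'a, 'y) module_scheme \<Rightarrow> ('k, 'b, 'z) module_scheme
    \<Rightarrow> ('a \<times> 'b \<Rightarrow> 'k) set" where
  "tensor_rel K M N =
     \<Inter>{U. submodule U K (free_pairs K M N) \<and> bilinear_relators K M N \<subseteq> U}"

definition tensor_mod ::
  "('k, 'x) ring_scheme \<Rightarrow> ('k, 'a, 'y) module_scheme \<Rightarrow> ('k, 'b, 'z) module_scheme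
    \<Rightarrow> ('k, ('a \<times> 'b \<Rightarrow> 'k) set) module" where
  "tensor_mod K M N = (let F = free_pairs K M N; U = tensor_rel K M N in
    \<lparr>carrier = a_rcosets\<^bsub>F\<^esub> U,
     mult = (\<lambda>_ _. undefined),
     one = undefined,
     zero = U,
     add = (\<lambda>s t. s <+>\<^bsub>F\<^esub> t),
     smult = (\<lambda>c t. \<Union>f\<in>t. U +>\<^bsub>F\<^esub> (c \<odot>\<^bsub>F\<^esub> f))\<rparr>)"

definition pure_tensor ::
  "('k, 'x) ring_scheme \<Rightarrow> ('k, 'a, 'y) module_scheme \<Rightarrow> ('k, 'b, 'z) module_scheme
    \<Rightarrow> 'a \<Rightarrow> 'b \<Rightarrow> ('a \<times> 'b \<Rightarrow> 'k) set" where
  "pure_tensor K M N m n = tensor_rel K M N +>\<^bsub>free_pairs K M N\<^esub> free_gen K (m, n)"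

text \<open>
  For bilinear \<open>f\<close> with values in \<open>P\<close>, \<open>tensor_lift K P f\<close> is the linear map on the tensor product
  sending \<open>m \<otimes> n\<close> to \<open>f m n\<close>: any representative \<open>\<Sum> c\<^sub>i (m\<^sub>i, n\<^sub>i)\<close> of the coset \<open>t\<close>
  yields the same value \<open>\<Sum> c\<^sub>i f m\<^sub>i n\<^sub>i\<close>. Sweedler notation is rendered with it: an expression
  \<open>f (h\<^sup>(\<^sup>0\<^sup>)) (h\<^sup>(\<^sup>1\<^sup>))\<close> is \<open>tensor_lift K P f (\<Delta> h)\<close>.
\<close>

definition tensor_lift ::
  "('k, 'x) ring_scheme \<Rightarrow> ('k, 'c, 'y) module_scheme \<Rightarrow> ('a \<Rightarrow> 'b \<Rightarrow> 'c)
    \<Rightarrow> ('a \<times> 'b \<Rightarrow> 'k) set \<Rightarrow> 'c" where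
  "tensor_lift K P f t =
     (THE v. \<forall>x\<in>t. v = (\<Oplus>\<^bsub>P\<^esub>p\<in>{p. x p \<noteq> \<zero>\<^bsub>K\<^esub>}. x p \<odot>\<^bsub>P\<^esub> f (fst p) (snd p)))"

definition tensor_assoc ::
  "('k, 'x) ring_scheme \<Rightarrow> ('k, 'a, 'y) module_scheme \<Rightarrow> ('k, 'b, 'z) module_scheme
    \<Rightarrow> ('k, 'c, 'w) module_scheme \<Rightarrow> (('a \<times> 'b \<Rightarrow> 'k) set \<times> 'c \<Rightarrow> 'k) set
    \<Rightarrow> ('a \<times> ('b \<times> 'c \<Rightarrow> 'k) set \<Rightarrow> 'k) set" where
  "tensor_assoc K M N P =
     (let T = tensor_mod K M (tensor_mod K N P) in
      tensor_lift K T (\<lambda>s p. tensor_lift K T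
        (\<lambda>m n. pure_tensor K M (tensor_mod K N P) m (pure_tensor K N P n p)) s))"

definition tensor_alg ::
  "('k, 'x) ring_scheme \<Rightarrow> ('k, 'a, 'y) module_scheme \<Rightarrow> ('k, 'b, 'z) module_scheme
    \<Rightarrow> ('k, ('a \<times> 'b \<Rightarrow> 'k) set) module" where
  "tensor_alg K A B = (let T = tensor_mod K A B in
     T\<lparr>mult := (\<lambda>s t. tensor_lift K T (\<lambda>a b. tensor_lift K T
          (\<lambda>c d. pure_tensor K A B (a \<otimes>\<^bsub>A\<^esub> c) (b \<otimes>\<^bsub>B\<^esub> d)) t) s),
       one := pure_tensor K A B \<one>\<^bsub>A\<^esub> \<one>\<^bsub>B\<^esub>\<rparr>)"

definition lin_maps ::
  "('k, 'x) ring_scheme \<Rightarrow> ('k, 'a, 'y) module_scheme \<Rightarrow> ('k, 'b, 'z) module_scheme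
    \<Rightarrow> ('a \<Rightarrow> 'b) set" where
  "lin_maps K M N = {f \<in> carrier M \<rightarrow> carrier N.
     (\<forall>x\<in>carrier M. \<forall>y\<in>carrier M. f (x \<oplus>\<^bsub>M\<^esub> y) = f x \<oplus>\<^bsub>N\<^esub> f y) \<and>
     (\<forall>c\<in>carrier K. \<forall>x\<in>carrier M. f (c \<odot>\<^bsub>M\<^esub> x) = c \<odot>\<^bsub>N\<^esub> f x)}"

section \<open>Hopf algebras, module algebras and Yetter--Drinfeld algebras\<close>

text \<open>The library locale \<open>algebra\<close> covers commutative algebras only.\<close>

locale assoc_algebra = module K A + K?: field K + A?: ring A for K (structure) and A (structure) +
  assumes smult_mult_left:
      "\<lbrakk>c \<in> carrier K; x \<in> carrier A; y \<in> carrier A\<rbrakk>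
        \<Longrightarrow> (c \<odot>\<^bsub>A\<^esub> x) \<otimes>\<^bsub>A\<^esub> y = c \<odot>\<^bsub>A\<^esub> (x \<otimes>\<^bsub>A\<^esub> y)"
    and smult_mult_right:
      "\<lbrakk>c \<in> carrier K; x \<in> carrier A; y \<in> carrier A\<rbrakk>
        \<Longrightarrow> x \<otimes>\<^bsub>A\<^esub> (c \<odot>\<^bsub>A\<^esub> y) = c \<odot>\<^bsub>A\<^esub> (x \<otimes>\<^bsub>A\<^esub> y)"

locale hopf_algebra = assoc_algebra K H for K (structure) and H (structure) +
  fixes \<Delta> :: "'c \<Rightarrow> ('c \<times> 'c \<Rightarrow> 'a) set" and \<epsilon> :: "'c \<Rightarrow> 'a" and S :: "'c \<Rightarrow> 'c"
  assumes comult_lin: "\<Delta> \<in> lin_maps K H (tensor_mod K H H)"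
    and counit_hom: "\<epsilon> \<in> ring_hom H K"
    and counit_smult:
      "\<lbrakk>c \<in> carrier K; h \<in> carrier H\<rbrakk> \<Longrightarrow> \<epsilon> (c \<odot>\<^bsub>H\<^esub> h) = c \<otimes>\<^bsub>K\<^esub> \<epsilon> h"
    and comult_coassoc:
      "h \<in> carrier H \<Longrightarrow>
        tensor_assoc K H H H
          (tensor_lift K (tensor_mod K (tensor_mod K H H) H)
             (\<lambda>x y. pure_tensor K (tensor_mod K H H) H (\<Delta> x) y) (\<Delta> h)) =
        tensor_lift K (tensor_mod K H (tensor_mod K H H))
          (\<lambda>x y. pure_tensor K H (tensor_mod K H H) x (\<Delta> y)) (\<Delta> h)"
    and counit_left: "h \<in> carrier H \<Longrightarrow> tensor_lift K H (\<lambda>x y. \<epsilon> x \<odot>\<^bsub>H\<^esub> y) (\<Delta> h) = h"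
    and counit_right: "h \<in> carrier H \<Longrightarrow> tensor_lift K H (\<lambda>x y. \<epsilon> y \<odot>\<^bsub>H\<^esub> x) (\<Delta> h) = h"
    and comult_mult:
      "\<lbrakk>g \<in> carrier H; h \<in> carrier H\<rbrakk> \<Longrightarrow> \<Delta> (g \<otimes>\<^bsub>H\<^esub> h) = \<Delta> g \<otimes>\<^bsub>tensor_alg K H H\<^esub> \<Delta> h"
    and comult_one: "\<Delta> \<one>\<^bsub>H\<^esub> = \<one>\<^bsub>tensor_alg K H H\<^esub>"
    and antipode_lin: "S \<in> lin_maps K H H"
    and antipode_left:
      "h \<in> carrier H \<Longrightarrow> tensor_lift K H (\<lambda>x y. S x \<otimes>\<^bsub>H\<^esub> y) (\<Delta> h) = \<epsilon> h \<odot>\<^bsub>H\<^esub> \<one>\<^bsub>H\<^esub>"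
    and antipode_right:
      "h \<in> carrier H \<Longrightarrow> tensor_lift K H (\<lambda>x y. x \<otimes>\<^bsub>H\<^esub> S y) (\<Delta> h) = \<epsilon> h \<odot>\<^bsub>H\<^esub> \<one>\<^bsub>H\<^esub>"

locale left_hopf_module_algebra =
  Hopf?: hopf_algebra K H \<Delta> \<epsilon> S + Alg?: assoc_algebra K A
  for K (structure) and H (structure) and \<Delta> \<epsilon> S and A (structure) +
  fixes act :: "'c \<Rightarrow> 'e \<Rightarrow> 'e"
  assumes act_lin_right: "h \<in> carrier H \<Longrightarrow> act h \<in> lin_maps K A A"
    and act_lin_left: "a \<in> carrier A \<Longrightarrow> (\<lambda>h. act h a) \<in> lin_maps K H A"
    and act_one: "a \<in> carrier A \<Longrightarrow> act \<one>\<^bsub>H\<^esub> a = a"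
    and act_mult:
      "\<lbrakk>g \<in> carrier H; h \<in> carrier H; a \<in> carrier A\<rbrakk> \<Longrightarrow> act (g \<otimes>\<^bsub>H\<^esub> h) a = act g (act h a)"
    and act_alg_mult:
      "\<lbrakk>h \<in> carrier H; a \<in> carrier A; b \<in> carrier A\<rbrakk> \<Longrightarrow>
        act h (a \<otimes>\<^bsub>A\<^esub> b) = tensor_lift K A (\<lambda>x y. act x a \<otimes>\<^bsub>A\<^esub> act y b) (\<Delta> h)"
    and act_alg_one: "h \<in> carrier H \<Longrightarrow> act h \<one>\<^bsub>A\<^esub> = \<epsilon> h \<odot>\<^bsub>A\<^esub> \<one>\<^bsub>A\<^esub>"

text \<open>
  The coaction makes \<open>A\<close> a right comodule algebra over the opposite algebra of \<open>H\<close>, whence the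
  reversed product in the second leg of \<open>coact_mult\<close>.
\<close>

locale yetter_drinfeld_algebra = left_hopf_module_algebra K H \<Delta> \<epsilon> S A act
  for K (structure) and H (structure) and \<Delta> \<epsilon> S and A (structure) and act +
  fixes \<rho> :: "'e \<Rightarrow> ('e \<times> 'c \<Rightarrow> 'a) set"
  assumes coact_lin: "\<rho> \<in> lin_maps K A (tensor_mod K A H)"
    and coact_coassoc:
      "a \<in> carrier A \<Longrightarrow>
        tensor_assoc K A H H
          (tensor_lift K (tensor_mod K (tensor_mod K A H) H)
             (\<lambda>x y. pure_tensor K (tensor_mod K A H) H (\<rho> x) y) (\<rho> a)) =
        tensor_lift K (tensor_mod K A (tensor_mod K H H))
          (\<lambda>x y. pure_tensor K A (tensor_mod K H H) x (\<Delta> y)) (\<rho> a)"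
    and coact_counit: "a \<in> carrier A \<Longrightarrow> tensor_lift K A (\<lambda>x y. \<epsilon> y \<odot>\<^bsub>A\<^esub> x) (\<rho> a) = a"
    and coact_mult:
      "\<lbrakk>a \<in> carrier A; b \<in> carrier A\<rbrakk> \<Longrightarrow>
        \<rho> (a \<otimes>\<^bsub>A\<^esub> b) =
        tensor_lift K (tensor_mod K A H)
          (\<lambda>a0 a1. tensor_lift K (tensor_mod K A H)
             (\<lambda>b0 b1. pure_tensor K A H (a0 \<otimes>\<^bsub>A\<^esub> b0) (b1 \<otimes>\<^bsub>H\<^esub> a1)) (\<rho> b)) (\<rho> a)"
    and coact_one: "\<rho> \<one>\<^bsub>A\<^esub> = pure_tensor K A H \<one>\<^bsub>A\<^esub> \<one>\<^bsub>H\<^esub>"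
    and yetter_drinfeld:
      "\<lbrakk>h \<in> carrier H; a \<in> carrier A\<rbrakk> \<Longrightarrow>
        tensor_lift K (tensor_mod K A H)
          (\<lambda>h0 h1. tensor_lift K (tensor_mod K A H)
             (\<lambda>x y. pure_tensor K A H x (y \<otimes>\<^bsub>H\<^esub> h0)) (\<rho> (act h1 a))) (\<Delta> h) =
        tensor_lift K (tensor_mod K A H)
          (\<lambda>h0 h1. tensor_lift K (tensor_mod K A H)
             (\<lambda>x y. pure_tensor K A H (act h0 x) (h1 \<otimes>\<^bsub>H\<^esub> y)) (\<rho> a)) (\<Delta> h)"

definition braided_tensor_alg ::
  "('k, 'x) ring_scheme \<Rightarrow> ('k, 'a, 'y) module_scheme \<Rightarrow> ('a \<Rightarrow> ('a \<times> 'h \<Rightarrow> 'k) set)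
    \<Rightarrow> ('k, 'b, 'z) module_scheme \<Rightarrow> ('h \<Rightarrow> 'b \<Rightarrow> 'b)
    \<Rightarrow> ('k, ('a \<times> 'b \<Rightarrow> 'k) set) module" where
  "braided_tensor_alg K A \<rho> B actB = (let T = tensor_mod K A B in
     T\<lparr>mult := (\<lambda>s t.
          tensor_lift K T (\<lambda>a b.
            tensor_lift K T (\<lambda>c d.
              tensor_lift K T (\<lambda>c0 c1.
                pure_tensor K A B (a \<otimes>\<^bsub>A\<^esub> c0) (actB c1 b \<otimes>\<^bsub>B\<^esub> d)) (\<rho> c)) t) s),
       one := pure_tensor K A B \<one>\<^bsub>A\<^esub> \<one>\<^bsub>B\<^esub>\<rparr>)"

definition diagonal_act ::
  "('k, 'x) ring_scheme \<Rightarrow> ('h \<Rightarrow> ('h \<times> 'h \<Rightarrow> 'k) set)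
    \<Rightarrow> ('k, 'a, 'y) module_scheme \<Rightarrow> ('h \<Rightarrow> 'a \<Rightarrow> 'a)
    \<Rightarrow> ('k, 'b, 'z) module_scheme \<Rightarrow> ('h \<Rightarrow> 'b \<Rightarrow> 'b)
    \<Rightarrow> 'h \<Rightarrow> ('a \<times> 'b \<Rightarrow> 'k) set \<Rightarrow> ('a \<times> 'b \<Rightarrow> 'k) set" where
  "diagonal_act K \<Delta> A actA B actB h t = (let T = tensor_mod K A B in
     tensor_lift K T (\<lambda>a b.
       tensor_lift K T (\<lambda>h0 h1. pure_tensor K A B (actA h0 a) (actB h1 b)) (\<Delta> h)) t)"

end

theory Submission
  imports Defs
begin

text \<open>
  By the universal property of the tensor product, an expression in Sweedler notation is the image of
  \<open>\<Delta> h\<close> or \<open>\<rho> a\<close> under a linear map, so that identities may be checked on pure tensors. Regard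
  \<open>A \<otimes> B\<close> as a left \<open>A\<close>- and right \<open>B\<close>-module. Its product is
  \<open>(a \<otimes> b)(c \<otimes> d) = a \<cdot> \<tau> b c \<cdot> d\<close>, where \<open>\<tau> b c = c\<^sub>0 \<otimes> c\<^sub>1 \<cdot> b\<close> is the braiding. Multiplicativity and
  coassociativity of \<open>\<rho>\<close> make \<open>\<tau>\<close> a twisting map, i.e. compatible with the products of \<open>A\<close> and of \<open>B\<close>,
  and then both bracketings of \<open>(a \<otimes> b)(c \<otimes> d)(e \<otimes> f)\<close> are \<open>a \<cdot> (\<tau> b c)(\<tau> d e) \<cdot> f\<close>. The
  Yetter--Drinfeld condition says that \<open>\<tau>\<close> is equivariant, whence \<open>h\<close> maps \<open>a \<cdot> \<tau> b c \<cdot> d\<close> to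
  \<open>(h\<^sub>0 \<cdot> a) \<cdot> \<tau> (h\<^sub>1 \<cdot> b) (h\<^sub>2 \<cdot> c) \<cdot> (h\<^sub>3 \<cdot> d)\<close>, the product of \<open>h\<^sub>0 \<cdot> (a \<otimes> b)\<close> and \<open>h\<^sub>1 \<cdot> (c \<otimes> d)\<close>.
\<close>

section \<open>Linear and bilinear maps\<close>

lemma lin_mapsI:
  assumes "\<And>x. x \<in> carrier M \<Longrightarrow> f x \<in> carrier N"
    and "\<And>x y. \<lbrakk>x \<in> carrier M; y \<in> carrier M\<rbrakk> \<Longrightarrow> f (x \<oplus>\<^bsub>M\<^esub> y) = f x \<oplus>\<^bsub>N\<^esub> f y"
    and "\<And>c x. \<lbrakk>c \<in> carrier K; x \<in> carrier M\<rbrakk> \<Longrightarrow> f (c \<odot>\<^bsub>M\<^esub> x) = c \<odot>\<^bsub>N\<^esub> f x"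
  shows "f \<in> lin_maps K M N"
  using assms by (auto simp: lin_maps_def)

lemma lin_maps_closed: "\<lbrakk>f \<in> lin_maps K M N; x \<in> carrier M\<rbrakk> \<Longrightarrow> f x \<in> carrier N"
  and lin_maps_add:
    "\<lbrakk>f \<in> lin_maps K M N; x \<in> carrier M; y \<in> carrier M\<rbrakk> \<Longrightarrow> f (x \<oplus>\<^bsub>M\<^esub> y) = f x \<oplus>\<^bsub>N\<^esub> f y"
  and lin_maps_smult:
    "\<lbrakk>f \<in> lin_maps K M N; c \<in> carrier K; x \<in> carrier M\<rbrakk> \<Longrightarrow> f (c \<odot>\<^bsub>M\<^esub> x) = c \<odot>\<^bsub>N\<^esub> f x"
  by (auto simp: lin_maps_def)

lemma lin_maps_cong:
  assumes "module K M" "f \<in> lin_maps K M N" "\<And>x. x \<in> carrier M \<Longrightarrow> f x = g x"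
  shows "g \<in> lin_maps K M N"
proof -
  interpret M: module K M by fact
  show ?thesis
    using assms(2) assms(3)[symmetric] by (auto simp: lin_maps_def Pi_iff)
qed

lemma lin_maps_record_update:
  "lin_maps K (M\<lparr>mult := m, one := u\<rparr>) N = lin_maps K M N"
  "lin_maps K M (N\<lparr>mult := n, one := v\<rparr>) = lin_maps K M N"
  by (simp_all add: lin_maps_def)

lemma lin_maps_id: "(\<lambda>x. x) \<in> lin_maps K M M"
  by (simp add: lin_maps_def)

lemma lin_maps_comp:
  "\<lbrakk>g \<in> lin_maps K N P; f \<in> lin_maps K M N\<rbrakk> \<Longrightarrow> (\<lambda>x. g (f x)) \<in> lin_maps K M P"
  by (auto simp: lin_maps_def Pi_iff)

lemma (in module) smult_lin: "c \<in> carrier R \<Longrightarrow> (\<lambda>v. c \<odot>\<^bsub>M\<^esub> v) \<in> lin_maps R M M"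
  by (intro lin_mapsI) (simp_all add: smult_r_distr smult_assoc1[symmetric] R.m_comm)

lemma lin_maps_abelian_group_hom:
  assumes "f \<in> lin_maps K M N" "module K M" "module K N"
  shows "abelian_group_hom M N f"
proof -
  interpret M: module K M by fact
  interpret N: module K N by fact
  show ?thesis
    by (intro abelian_group_homI group_hom.intro group_hom_axioms.intro homI)
      (simp_all add: M.abelian_group_axioms N.abelian_group_axioms M.a_group N.a_group
        lin_maps_closed[OF assms(1)] lin_maps_add[OF assms(1)])
qed

lemma lin_maps_minus:
  assumes "f \<in> lin_maps K M N" "module K M" "module K N" "x \<in> carrier M" "y \<in> carrier M"
  shows "f (x \<ominus>\<^bsub>M\<^esub> y) = f x \<ominus>\<^bsub>N\<^esub> f y"
proof -
  interpret abelian_group_hom M N f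
    using assms(1-3) by (rule lin_maps_abelian_group_hom)
  show ?thesis using assms(4,5) by (simp add: a_minus_def)
qed

lemma lin_maps_kernel_submodule:
  assumes "f \<in> lin_maps K M N" "module K M" "module K N"
  shows "submodule (a_kernel M N f) K M"
proof -
  interpret N: module K N by fact
  interpret module K M by fact
  interpret abelian_group_hom M N f
    using assms by (rule lin_maps_abelian_group_hom)
  show ?thesis
    using additive_subgroup.a_subgroup[OF additive_subgroup_a_kernel]
    by (intro submodule.intro submodule_axioms.intro)
      (auto simp: a_kernel_def' lin_maps_smult[OF assms(1)])
qed

definition bilin_maps ::
  "('k, 'x) ring_scheme \<Rightarrow> ('k, 'a, 'y) module_scheme \<Rightarrow> ('k, 'b, 'z) module_scheme
    \<Rightarrow> ('k, 'c, 'w) module_scheme \<Rightarrow> ('a \<Rightarrow> 'b \<Rightarrow> 'c) set" where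
  "bilin_maps K M N P =
    {f. (\<forall>n\<in>carrier N. (\<lambda>m. f m n) \<in> lin_maps K M P) \<and> (\<forall>m\<in>carrier M. f m \<in> lin_maps K N P)}"

lemma bilin_mapsI:
  assumes "\<And>n. n \<in> carrier N \<Longrightarrow> (\<lambda>m. f m n) \<in> lin_maps K M P"
    and "\<And>m. m \<in> carrier M \<Longrightarrow> (\<lambda>n. f m n) \<in> lin_maps K N P"
  shows "f \<in> bilin_maps K M N P"
  using assms by (auto simp: bilin_maps_def)

lemma bilin_maps_left: "\<lbrakk>f \<in> bilin_maps K M N P; n \<in> carrier N\<rbrakk> \<Longrightarrow> (\<lambda>m. f m n) \<in> lin_maps K M P"
  and bilin_maps_right: "\<lbrakk>f \<in> bilin_maps K M N P; m \<in> carrier M\<rbrakk> \<Longrightarrow> f m \<in> lin_maps K N P"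
  by (auto simp: bilin_maps_def)

lemma bilin_maps_closed:
  "\<lbrakk>f \<in> bilin_maps K M N P; m \<in> carrier M; n \<in> carrier N\<rbrakk> \<Longrightarrow> f m n \<in> carrier P"
  by (auto intro: lin_maps_closed bilin_maps_right)

lemma bilin_maps_comp_left:
  "\<lbrakk>f \<in> bilin_maps K M N P; g \<in> lin_maps K L M; n \<in> carrier N\<rbrakk>
    \<Longrightarrow> (\<lambda>x. f (g x) n) \<in> lin_maps K L P"
  by (rule lin_maps_comp[OF bilin_maps_left])

lemma bilin_maps_comp_right:
  "\<lbrakk>f \<in> bilin_maps K M N P; g \<in> lin_maps K L N; m \<in> carrier M\<rbrakk>
    \<Longrightarrow> (\<lambda>x. f m (g x)) \<in> lin_maps K L P"
  by (rule lin_maps_comp[OF bilin_maps_right])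

named_theorems linear_intros "linearity, closure and module conditions of Sweedler sums"

lemmas lin_maps_intros = lin_maps_comp lin_maps_closed
lemmas bilin_maps_intros = bilin_maps_comp_left bilin_maps_comp_right bilin_maps_closed

declare lin_maps_id [linear_intros] bilin_mapsI [linear_intros]

section \<open>Free modules\<close>

lemma module_free_mod:
  assumes "cring K"
  shows "module K (free_mod K I)"
proof -
  interpret cring K by fact
  have finite_support_add: "finite {i. f i \<oplus>\<^bsub>K\<^esub> g i \<noteq> \<zero>\<^bsub>K\<^esub>}"
    if "finite {i. f i \<noteq> \<zero>\<^bsub>K\<^esub>}" "finite {i. g i \<noteq> \<zero>\<^bsub>K\<^esub>}" for f g :: "'c \<Rightarrow> 'a"
    by (rule finite_subset[OF _ finite_UnI[OF that]]) auto
  have finite_support_smult: "finite {i. c \<otimes>\<^bsub>K\<^esub> f i \<noteq> \<zero>\<^bsub>K\<^esub>}"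
    if "finite {i. f i \<noteq> \<zero>\<^bsub>K\<^esub>}" "c \<in> carrier K" for f :: "'c \<Rightarrow> 'a" and c
    by (rule finite_subset[OF _ that(1)]) (use that in auto)
  have additive_inverse: "\<exists>g\<in>carrier (free_mod K I). g \<oplus>\<^bsub>free_mod K I\<^esub> f = \<zero>\<^bsub>free_mod K I\<^esub>"
    if f: "f \<in> carrier (free_mod K I)" for f
  proof
    have "finite {i. \<ominus>\<^bsub>K\<^esub> f i \<noteq> \<zero>\<^bsub>K\<^esub>}"
      by (rule finite_subset[of _ "{i. f i \<noteq> \<zero>\<^bsub>K\<^esub>}"]) (use f in \<open>auto simp: free_mod_def\<close>)
    then show "(\<lambda>i. \<ominus>\<^bsub>K\<^esub> f i) \<in> carrier (free_mod K I)"
      using f by (auto simp: free_mod_def)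
    show "(\<lambda>i. \<ominus>\<^bsub>K\<^esub> f i) \<oplus>\<^bsub>free_mod K I\<^esub> f = \<zero>\<^bsub>free_mod K I\<^esub>"
      using f by (auto simp: free_mod_def l_neg)
  qed
  show ?thesis
  proof (rule moduleI)
    show "abelian_group (free_mod K I)"
      by (rule abelian_groupI)
        (use additive_inverse in \<open>auto simp: free_mod_def a_ac intro!: finite_support_add\<close>)
  qed (auto simp: free_mod_def finite_support_smult l_distr r_distr m_assoc is_cring)
qed

lemma free_gen_closed:
  assumes "cring K" "i \<in> I"
  shows "free_gen K i \<in> carrier (free_mod K I)"
proof -
  interpret cring K by fact
  show ?thesis using assms(2) by (auto simp: free_gen_def free_mod_def)
qed

lemma free_mod_induct [consumes 2, case_names zero add]:
  assumes "cring K" and x: "x \<in> carrier (free_mod K I)"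
    and zero: "Q \<zero>\<^bsub>free_mod K I\<^esub>"
    and add: "\<And>x c i. \<lbrakk>x \<in> carrier (free_mod K I); Q x; c \<in> carrier K; i \<in> I\<rbrakk>
        \<Longrightarrow> Q (x \<oplus>\<^bsub>free_mod K I\<^esub> c \<odot>\<^bsub>free_mod K I\<^esub> free_gen K i)"
  shows "Q x"
proof -
  interpret cring K by fact
  have "Q x" if "finite J" "x \<in> carrier (free_mod K I)" "{i. x i \<noteq> \<zero>\<^bsub>K\<^esub>} = J" for x J
    using that
  proof (induction J arbitrary: x rule: finite_induct)
    case empty
    then show ?case using zero by (simp add: free_mod_def fun_eq_iff)
  next
    case (insert j J)
    let ?y = "x(j := \<zero>\<^bsub>K\<^esub>)"
    have y_support: "{i. ?y i \<noteq> \<zero>\<^bsub>K\<^esub>} = J"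
      using insert by auto
    then have y: "?y \<in> carrier (free_mod K I)"
      using insert by (auto simp: free_mod_def)
    have j: "j \<in> I" "x j \<in> carrier K"
      using insert by (auto simp: free_mod_def)
    have "x = ?y \<oplus>\<^bsub>free_mod K I\<^esub> x j \<odot>\<^bsub>free_mod K I\<^esub> free_gen K j"
      using insert.prems by (auto simp: free_mod_def free_gen_def fun_eq_iff)
    then show ?case
      using add[OF y insert.IH[OF y y_support] j(2,1)] by metis
  qed
  then show ?thesis using x by (auto simp: free_mod_def)
qed

definition free_eval ::
  "('k, 'x) ring_scheme \<Rightarrow> ('k, 'c, 'y) module_scheme \<Rightarrow> ('i \<Rightarrow> 'c) \<Rightarrow> ('i \<Rightarrow> 'k) \<Rightarrow> 'c" where
  "free_eval K P \<phi> x = (\<Oplus>\<^bsub>P\<^esub>i\<in>{i. x i \<noteq> \<zero>\<^bsub>K\<^esub>}. x i \<odot>\<^bsub>P\<^esub> \<phi> i)"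

text \<open>
  Unlike \<open>finsum_cong'\<close> of the library, the following needs no closure condition; this spares
  the congruence rule \<open>tensor_lift_cong\<close> below all linearity conditions.
\<close>

lemma finsum_cong_pointwise:
  assumes "\<And>i. i \<in> I \<Longrightarrow> f i = g i"
  shows "finsum P f I = finsum P g I"
proof -
  have fold: "(J, y) \<in> foldSetD D (add P \<circ> h') e"
    if "(J, y) \<in> foldSetD D (add P \<circ> h) e" "J \<subseteq> I" "\<And>i. i \<in> I \<Longrightarrow> h i = h' i" for J y D h h' e
    using that
  proof (induction rule: foldSetD.induct)
    case (insertI j J y)
    then show ?case
      using foldSetD.insertI[of j J "add P \<circ> h'" y] by (simp add: comp_def)
  qed (rule foldSetD.emptyI)
  have "(I, y) \<in> foldSetD D (add P \<circ> f) e \<longleftrightarrow> (I, y) \<in> foldSetD D (add P \<circ> g) e" for y D e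
    using assms by (auto intro: fold)
  then show ?thesis
    by (simp add: finsum_def finprod_def foldD_def)
qed

context
  fixes K :: "('k, 'x) ring_scheme" and P :: "('k, 'c, 'y) module_scheme"
    and I :: "'i set" and \<phi> :: "'i \<Rightarrow> 'c"
  assumes P: "module K P" and \<phi>: "\<phi> \<in> I \<rightarrow> carrier P"
begin

interpretation P: module K P by (rule P)

lemma free_eval_summand_closed:
  "\<lbrakk>x \<in> carrier (free_mod K I); J \<subseteq> I\<rbrakk> \<Longrightarrow> (\<lambda>i. x i \<odot>\<^bsub>P\<^esub> \<phi> i) \<in> J \<rightarrow> carrier P"
  using \<phi> by (auto simp: free_mod_def)

lemma free_eval_superset:
  assumes x: "x \<in> carrier (free_mod K I)" and J: "finite J" "{i. x i \<noteq> \<zero>\<^bsub>K\<^esub>} \<subseteq> J" "J \<subseteq> I"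
  shows "free_eval K P \<phi> x = (\<Oplus>\<^bsub>P\<^esub>i\<in>J. x i \<odot>\<^bsub>P\<^esub> \<phi> i)"
  unfolding free_eval_def
  by (rule P.add.finprod_mono_neutral_cong_left[OF J(1,2) _ _ free_eval_summand_closed[OF x J(3)]])
    (use J \<phi> in \<open>auto simp: Pi_iff subset_iff\<close>)

lemma free_mod_support:
  "x \<in> carrier (free_mod K I) \<Longrightarrow> finite {i. x i \<noteq> \<zero>\<^bsub>K\<^esub>}"
  "x \<in> carrier (free_mod K I) \<Longrightarrow> {i. x i \<noteq> \<zero>\<^bsub>K\<^esub>} \<subseteq> I"
  by (auto simp: free_mod_def)

lemma free_eval_add:
  assumes x: "x \<in> carrier (free_mod K I)" and y: "y \<in> carrier (free_mod K I)"
  shows "free_eval K P \<phi> (x \<oplus>\<^bsub>free_mod K I\<^esub> y) = free_eval K P \<phi> x \<oplus>\<^bsub>P\<^esub> free_eval K P \<phi> y"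
proof -
  interpret F: module K "free_mod K I"
    by (rule module_free_mod) (rule P.is_cring)
  define J where "J = {i. x i \<noteq> \<zero>\<^bsub>K\<^esub>} \<union> {i. y i \<noteq> \<zero>\<^bsub>K\<^esub>}"
  have J: "finite J" "J \<subseteq> I"
    using free_mod_support x y by (auto simp: J_def)
  have "free_eval K P \<phi> (x \<oplus>\<^bsub>free_mod K I\<^esub> y) = (\<Oplus>\<^bsub>P\<^esub>i\<in>J. (x \<oplus>\<^bsub>free_mod K I\<^esub> y) i \<odot>\<^bsub>P\<^esub> \<phi> i)"
    by (rule free_eval_superset[OF F.a_closed[OF x y] J(1) _ J(2)]) (auto simp: J_def free_mod_def)
  also have "\<dots> = (\<Oplus>\<^bsub>P\<^esub>i\<in>J. x i \<odot>\<^bsub>P\<^esub> \<phi> i \<oplus>\<^bsub>P\<^esub> y i \<odot>\<^bsub>P\<^esub> \<phi> i)"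
    by (rule finsum_cong_pointwise)
      (use x y J \<phi> in \<open>auto simp: free_mod_def Pi_iff subset_iff intro!: P.smult_l_distr\<close>)
  also have "\<dots> = (\<Oplus>\<^bsub>P\<^esub>i\<in>J. x i \<odot>\<^bsub>P\<^esub> \<phi> i) \<oplus>\<^bsub>P\<^esub> (\<Oplus>\<^bsub>P\<^esub>i\<in>J. y i \<odot>\<^bsub>P\<^esub> \<phi> i)"
    using x y J by (intro P.finsum_addf free_eval_summand_closed)
  also have "\<dots> = free_eval K P \<phi> x \<oplus>\<^bsub>P\<^esub> free_eval K P \<phi> y"
    using free_eval_superset[OF x J(1) _ J(2)] free_eval_superset[OF y J(1) _ J(2)]
    by (simp add: J_def)
  finally show ?thesis .
qed

lemma free_eval_smult:
  assumes c: "c \<in> carrier K" and x: "x \<in> carrier (free_mod K I)"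
  shows "free_eval K P \<phi> (c \<odot>\<^bsub>free_mod K I\<^esub> x) = c \<odot>\<^bsub>P\<^esub> free_eval K P \<phi> x"
proof -
  interpret F: module K "free_mod K I"
    by (rule module_free_mod) (rule P.is_cring)
  let ?J = "{i. x i \<noteq> \<zero>\<^bsub>K\<^esub>}"
  note J = free_mod_support[OF x]
  have "free_eval K P \<phi> (c \<odot>\<^bsub>free_mod K I\<^esub> x) = (\<Oplus>\<^bsub>P\<^esub>i\<in>?J. (c \<odot>\<^bsub>free_mod K I\<^esub> x) i \<odot>\<^bsub>P\<^esub> \<phi> i)"
    by (rule free_eval_superset[OF F.smult_closed[OF c x] J(1) _ J(2)])
      (use c in \<open>auto simp: free_mod_def\<close>)
  also have "\<dots> = (\<Oplus>\<^bsub>P\<^esub>i\<in>?J. c \<odot>\<^bsub>P\<^esub> (x i \<odot>\<^bsub>P\<^esub> \<phi> i))"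
    by (rule finsum_cong_pointwise)
      (use c x \<phi> in \<open>auto simp: free_mod_def Pi_iff intro!: P.smult_assoc1\<close>)
  also have "\<dots> = c \<odot>\<^bsub>P\<^esub> free_eval K P \<phi> x"
    unfolding free_eval_def
    by (rule P.finsum_smult_ldistr[OF J(1) c free_eval_summand_closed[OF x J(2)], symmetric])
  finally show ?thesis .
qed

lemma free_eval_lin: "free_eval K P \<phi> \<in> lin_maps K (free_mod K I) P"
proof (rule lin_mapsI)
  fix x assume x: "x \<in> carrier (free_mod K I)"
  show "free_eval K P \<phi> x \<in> carrier P"
    unfolding free_eval_def
    by (rule P.finsum_closed[OF free_eval_summand_closed[OF x free_mod_support(2)[OF x]]])
qed (rule free_eval_add free_eval_smult; assumption)+

lemma free_eval_gen: "i \<in> I \<Longrightarrow> free_eval K P \<phi> (free_gen K i) = \<phi> i"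
  using free_eval_superset[of "free_gen K i" "{i}"] free_gen_closed[OF P.is_cring, of i] \<phi>
  by (fastforce simp: free_gen_def Pi_iff split: if_splits)

end

section \<open>The universal property of the tensor product\<close>

locale module_pair = M: module K M + N: module K N
  for K :: "('k, 'x) ring_scheme" and M :: "('k, 'a, 'y) module_scheme"
    and N :: "('k, 'b, 'z) module_scheme"
begin

abbreviation "F \<equiv> free_pairs K M N"
abbreviation "U \<equiv> tensor_rel K M N"
abbreviation "T \<equiv> tensor_mod K M N"
abbreviation pure (infixl "\<boxtimes>" 69) where "m \<boxtimes> n \<equiv> pure_tensor K M N m n"

sublocale F: module K F
  by (rule module_free_mod) (rule M.is_cring)

lemma free_gen_pair_closed: "\<lbrakk>m \<in> carrier M; n \<in> carrier N\<rbrakk> \<Longrightarrow> free_gen K (m, n) \<in> carrier F"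
  by (rule free_gen_closed[OF M.is_cring]) simp

lemma bilinear_relators_closed: "bilinear_relators K M N \<subseteq> carrier F"
  unfolding bilinear_relators_def Let_def by (auto simp: free_gen_pair_closed)

lemma tensor_rel_submodule: "submodule U K F"
proof (rule F.submoduleI)
  show "U \<subseteq> carrier F"
    unfolding tensor_rel_def
    by (rule Inter_lower) (simp add: bilinear_relators_closed F.carrier_is_submodule)
  show "\<zero>\<^bsub>F\<^esub> \<in> U"
    using subgroup.one_closed[OF submodule.axioms(1)] by (fastforce simp: tensor_rel_def)
qed (auto simp: tensor_rel_def F.submoduleE(3,4,5))

sublocale U: abelian_subgroup U F
  by (rule abelian_subgroupI3)
    (auto simp: additive_subgroup_def submodule.axioms(1)[OF tensor_rel_submodule]
      F.abelian_group_axioms)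

abbreviation tensor_class where "tensor_class x \<equiv> U +>\<^bsub>F\<^esub> x"

lemma tensor_carrierE:
  assumes "t \<in> carrier T"
  obtains x where "x \<in> carrier F" "t = tensor_class x"
  using assms by (auto simp: tensor_mod_def Let_def A_RCOSETS_def')

lemma tensor_class_closed: "x \<in> carrier F \<Longrightarrow> tensor_class x \<in> carrier T"
  by (auto simp: tensor_mod_def Let_def A_RCOSETS_def')

lemma tensor_class_add:
  "\<lbrakk>x \<in> carrier F; y \<in> carrier F\<rbrakk> \<Longrightarrow> tensor_class x \<oplus>\<^bsub>T\<^esub> tensor_class y = tensor_class (x \<oplus>\<^bsub>F\<^esub> y)"
  by (simp add: tensor_mod_def Let_def U.a_rcos_sum)

lemma tensor_class_zero: "tensor_class \<zero>\<^bsub>F\<^esub> = \<zero>\<^bsub>T\<^esub>"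
  by (simp add: tensor_mod_def Let_def U.a_rcos_const)

lemma tensor_class_eqI:
  assumes "x \<in> carrier F" "y \<in> carrier F" "x \<ominus>\<^bsub>F\<^esub> y \<in> U"
  shows "tensor_class x = tensor_class y"
  by (rule U.a_repr_independence'[symmetric])
    (use assms in \<open>simp_all add: U.a_rcos_module a_minus_def\<close>)

lemma tensor_class_smult:
  assumes c: "c \<in> carrier K" and x: "x \<in> carrier F"
  shows "c \<odot>\<^bsub>T\<^esub> tensor_class x = tensor_class (c \<odot>\<^bsub>F\<^esub> x)"
proof -
  have "tensor_class (c \<odot>\<^bsub>F\<^esub> y) = tensor_class (c \<odot>\<^bsub>F\<^esub> x)" if y: "y \<in> tensor_class x" for y
  proof (rule tensor_class_eqI)
    have "y \<in> carrier F" by (rule U.a_elemrcos_carrier[OF x y])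
    moreover have "c \<odot>\<^bsub>F\<^esub> (y \<oplus>\<^bsub>F\<^esub> \<ominus>\<^bsub>F\<^esub> x) \<in> U"
      by (rule F.submoduleE(4)[OF tensor_rel_submodule c]) (rule U.a_rcos_module_imp[OF x y])
    ultimately show "c \<odot>\<^bsub>F\<^esub> y \<ominus>\<^bsub>F\<^esub> c \<odot>\<^bsub>F\<^esub> x \<in> U"
      using x c by (simp add: F.smult_r_distr F.smult_r_minus a_minus_def)
  qed (use x c U.a_elemrcos_carrier[OF x y] in auto)
  moreover have "x \<in> tensor_class x"
    by (rule U.a_rcos_self[OF x])
  ultimately have "(\<Union>y\<in>tensor_class x. tensor_class (c \<odot>\<^bsub>F\<^esub> y)) = tensor_class (c \<odot>\<^bsub>F\<^esub> x)"
    by blast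
  then show ?thesis
    by (simp add: tensor_mod_def Let_def)
qed

lemma tensor_module: "module K T"
proof (rule moduleI)
  interpret Q: comm_group "F A_Mod U"
    by (rule U.a_factorgroup_is_comm_group)
  have quotient:
    "carrier (F A_Mod U) = carrier T" "mult (F A_Mod U) = add T" "one (F A_Mod U) = zero T"
    by (simp_all add: A_FactGroup_def' tensor_mod_def Let_def)
  show "abelian_group T"
    by (rule abelian_groupI)
      (fact Q.m_closed[unfolded quotient] Q.one_closed[unfolded quotient] Q.m_assoc[unfolded quotient]
        Q.m_comm[unfolded quotient] Q.l_one[unfolded quotient] Q.l_inv_ex[unfolded quotient])+
next
  fix a b s assume "a \<in> carrier K" "b \<in> carrier K" "s \<in> carrier T"
  then show "(a \<oplus>\<^bsub>K\<^esub> b) \<odot>\<^bsub>T\<^esub> s = a \<odot>\<^bsub>T\<^esub> s \<oplus>\<^bsub>T\<^esub> b \<odot>\<^bsub>T\<^esub> s"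
    and "(a \<otimes>\<^bsub>K\<^esub> b) \<odot>\<^bsub>T\<^esub> s = a \<odot>\<^bsub>T\<^esub> (b \<odot>\<^bsub>T\<^esub> s)"
    by (elim tensor_carrierE;
        simp add: tensor_class_smult tensor_class_add F.smult_l_distr F.smult_assoc1)+
next
  fix a s t assume "a \<in> carrier K" "s \<in> carrier T" "t \<in> carrier T"
  then show "a \<odot>\<^bsub>T\<^esub> (s \<oplus>\<^bsub>T\<^esub> t) = a \<odot>\<^bsub>T\<^esub> s \<oplus>\<^bsub>T\<^esub> a \<odot>\<^bsub>T\<^esub> t"
    by (elim tensor_carrierE) (simp add: tensor_class_smult tensor_class_add F.smult_r_distr)
next
  fix a s assume "a \<in> carrier K" "s \<in> carrier T"
  then show "a \<odot>\<^bsub>T\<^esub> s \<in> carrier T"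
    by (elim tensor_carrierE) (simp add: tensor_class_smult tensor_class_closed)
next
  fix s assume "s \<in> carrier T"
  then show "\<one>\<^bsub>K\<^esub> \<odot>\<^bsub>T\<^esub> s = s"
    by (elim tensor_carrierE) (simp add: tensor_class_smult)
qed (rule M.is_cring)

sublocale T: module K T
  by (rule tensor_module)

lemma pure_bilin: "pure_tensor K M N \<in> bilin_maps K M N T"
proof -
  let ?e = "free_gen K"
  have relators_vanish: "tensor_class x = tensor_class y"
    if "x \<ominus>\<^bsub>F\<^esub> y \<in> bilinear_relators K M N" "x \<in> carrier F" "y \<in> carrier F" for x y
    using that by (intro tensor_class_eqI) (auto simp: tensor_rel_def)
  have relators:
    "\<And>m m' n. \<lbrakk>m \<in> carrier M; m' \<in> carrier M; n \<in> carrier N\<rbrakk>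
      \<Longrightarrow> ?e (m \<oplus>\<^bsub>M\<^esub> m', n) \<ominus>\<^bsub>F\<^esub> (?e (m, n) \<oplus>\<^bsub>F\<^esub> ?e (m', n)) \<in> bilinear_relators K M N"
    "\<And>m n n'. \<lbrakk>m \<in> carrier M; n \<in> carrier N; n' \<in> carrier N\<rbrakk>
      \<Longrightarrow> ?e (m, n \<oplus>\<^bsub>N\<^esub> n') \<ominus>\<^bsub>F\<^esub> (?e (m, n) \<oplus>\<^bsub>F\<^esub> ?e (m, n')) \<in> bilinear_relators K M N"
    "\<And>c m n. \<lbrakk>c \<in> carrier K; m \<in> carrier M; n \<in> carrier N\<rbrakk>
      \<Longrightarrow> ?e (c \<odot>\<^bsub>M\<^esub> m, n) \<ominus>\<^bsub>F\<^esub> c \<odot>\<^bsub>F\<^esub> ?e (m, n) \<in> bilinear_relators K M N"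
    "\<And>c m n. \<lbrakk>c \<in> carrier K; m \<in> carrier M; n \<in> carrier N\<rbrakk>
      \<Longrightarrow> ?e (m, c \<odot>\<^bsub>N\<^esub> n) \<ominus>\<^bsub>F\<^esub> c \<odot>\<^bsub>F\<^esub> ?e (m, n) \<in> bilinear_relators K M N"
    unfolding bilinear_relators_def Let_def by blast+
  show ?thesis
    unfolding pure_tensor_def
    by (intro bilin_mapsI lin_mapsI)
      (simp_all add: tensor_class_closed tensor_class_add tensor_class_smult free_gen_pair_closed
        relators[THEN relators_vanish])
qed

lemmas pure_closed [simp] = bilin_maps_closed[OF pure_bilin]

lemma pure_smult_left:
  "\<lbrakk>c \<in> carrier K; m \<in> carrier M; n \<in> carrier N\<rbrakk> \<Longrightarrow> (c \<odot>\<^bsub>M\<^esub> m) \<boxtimes> n = c \<odot>\<^bsub>T\<^esub> (m \<boxtimes> n)"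
  by (rule lin_maps_smult[OF bilin_maps_left[OF pure_bilin]])

lemma pure_smult_right:
  "\<lbrakk>c \<in> carrier K; m \<in> carrier M; n \<in> carrier N\<rbrakk> \<Longrightarrow> m \<boxtimes> (c \<odot>\<^bsub>N\<^esub> n) = c \<odot>\<^bsub>T\<^esub> (m \<boxtimes> n)"
  by (rule lin_maps_smult[OF bilin_maps_right[OF pure_bilin]])

lemma pure_induct [consumes 1, case_names pure add]:
  assumes t: "t \<in> carrier T"
    and pure: "\<And>m n. \<lbrakk>m \<in> carrier M; n \<in> carrier N\<rbrakk> \<Longrightarrow> Q (m \<boxtimes> n)"
    and add: "\<And>s t. \<lbrakk>s \<in> carrier T; t \<in> carrier T; Q s; Q t\<rbrakk> \<Longrightarrow> Q (s \<oplus>\<^bsub>T\<^esub> t)"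
  shows "Q t"
proof -
  obtain x where x: "x \<in> carrier F" "t = tensor_class x"
    using tensor_carrierE[OF t] .
  from M.is_cring x(1) have "Q (tensor_class x)"
  proof (induction x rule: free_mod_induct)
    case zero
    have "\<zero>\<^bsub>T\<^esub> = \<zero>\<^bsub>M\<^esub> \<boxtimes> \<zero>\<^bsub>N\<^esub>"
      using pure_smult_left[of "\<zero>\<^bsub>K\<^esub>" "\<zero>\<^bsub>M\<^esub>" "\<zero>\<^bsub>N\<^esub>"] by simp
    then show ?case
      using pure[of "\<zero>\<^bsub>M\<^esub>" "\<zero>\<^bsub>N\<^esub>"] by (simp add: tensor_class_zero)
  next
    case (add x c i)
    obtain m n where i: "i = (m, n)" "m \<in> carrier M" "n \<in> carrier N"
      using add by blast
    have "tensor_class (x \<oplus>\<^bsub>F\<^esub> c \<odot>\<^bsub>F\<^esub> free_gen K i) = tensor_class x \<oplus>\<^bsub>T\<^esub> (c \<odot>\<^bsub>M\<^esub> m) \<boxtimes> n"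
      using add i pure_smult_left[of c m n]
      by (simp add: tensor_class_add[symmetric] tensor_class_smult[symmetric] free_gen_pair_closed
          pure_tensor_def)
    then show ?case
      using add i by (simp add: assms(2,3) tensor_class_closed)
  qed
  then show ?thesis using x by simp
qed

lemma lin_maps_ext:
  assumes "t \<in> carrier T" "f \<in> lin_maps K T P" "g \<in> lin_maps K T P"
    and "\<And>m n. \<lbrakk>m \<in> carrier M; n \<in> carrier N\<rbrakk> \<Longrightarrow> f (m \<boxtimes> n) = g (m \<boxtimes> n)"
  shows "f t = g t"
  using assms(1)
proof (induction rule: pure_induct)
  case (add s t)
  then show ?case
    using lin_maps_add[OF assms(2) add(1,2)] lin_maps_add[OF assms(3) add(1,2)] by simp
qed (rule assms(4))

lemma lift_free_eval:
  "tensor_lift K P f t = (THE v. \<forall>x\<in>t. v = free_eval K P (\<lambda>p. f (fst p) (snd p)) x)"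
  by (simp only: tensor_lift_def free_eval_def)

lemma lift_cong:
  assumes "t \<in> carrier T"
    and "\<And>m n. \<lbrakk>m \<in> carrier M; n \<in> carrier N\<rbrakk> \<Longrightarrow> f m n = g m n"
  shows "tensor_lift K P f t = tensor_lift K P g t"
proof -
  obtain x where x: "x \<in> carrier F" "t = tensor_class x"
    using tensor_carrierE[OF assms(1)] .
  have "free_eval K P (\<lambda>p. f (fst p) (snd p)) y = free_eval K P (\<lambda>p. g (fst p) (snd p)) y"
    if "y \<in> t" for y
  proof -
    have "y \<in> carrier F"
      using that U.a_elemrcos_carrier[OF x(1)] x(2) by simp
    then have "fst p \<in> carrier M \<and> snd p \<in> carrier N" if "y p \<noteq> \<zero>\<^bsub>K\<^esub>" for p
      using that by (cases p) (fastforce simp: free_mod_def)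
    then show ?thesis
      unfolding free_eval_def by (intro finsum_cong_pointwise) (simp add: assms(2))
  qed
  then show ?thesis
    by (simp add: lift_free_eval)
qed

context
  fixes P :: "('k, 'c, 'w) module_scheme" and f :: "'a \<Rightarrow> 'b \<Rightarrow> 'c"
  assumes P: "module K P" and f: "f \<in> bilin_maps K M N P"
begin

interpretation P: module K P by (rule P)

abbreviation (input) "eval_pairs \<equiv> free_eval K P (\<lambda>p. f (fst p) (snd p))"

lemma eval_pairs_lin: "eval_pairs \<in> lin_maps K F P"
  by (rule free_eval_lin[OF P]) (use bilin_maps_closed[OF f] in auto)

lemma eval_pairs_gen: "\<lbrakk>m \<in> carrier M; n \<in> carrier N\<rbrakk> \<Longrightarrow> eval_pairs (free_gen K (m, n)) = f m n"
  using free_eval_gen[OF P, of "\<lambda>p. f (fst p) (snd p)" "carrier M \<times> carrier N" "(m, n)"]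
    bilin_maps_closed[OF f] by (auto simp: Pi_iff)

lemmas eval_pairs_minus = lin_maps_minus[OF eval_pairs_lin F.module_axioms P]

lemma tensor_rel_subset_kernel: "U \<subseteq> a_kernel F P eval_pairs"
proof -
  have minus_self: "v \<ominus>\<^bsub>P\<^esub> v = \<zero>\<^bsub>P\<^esub>" if "v \<in> carrier P" for v
    using that by (simp add: P.minus_eq P.r_neg)
  note f_left = bilin_maps_left[OF f] and f_right = bilin_maps_right[OF f]
  have "eval_pairs r = \<zero>\<^bsub>P\<^esub>" if "r \<in> bilinear_relators K M N" for r
    using that unfolding bilinear_relators_def Let_def
    by (auto simp: eval_pairs_minus lin_maps_add[OF eval_pairs_lin] lin_maps_smult[OF eval_pairs_lin]
        eval_pairs_gen free_gen_pair_closed bilin_maps_closed[OF f] lin_maps_add[OF f_left]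
        lin_maps_add[OF f_right] lin_maps_smult[OF f_left] lin_maps_smult[OF f_right] minus_self)
  then have "bilinear_relators K M N \<subseteq> a_kernel F P eval_pairs"
    using bilinear_relators_closed by (auto simp: a_kernel_def')
  then show ?thesis
    using lin_maps_kernel_submodule[OF eval_pairs_lin F.module_axioms P]
    unfolding tensor_rel_def by (intro Inter_lower) simp
qed

lemma eval_pairs_representative:
  assumes x: "x \<in> carrier F" and y: "y \<in> tensor_class x"
  shows "eval_pairs y = eval_pairs x"
proof -
  have y_closed: "y \<in> carrier F"
    by (rule U.a_elemrcos_carrier[OF x y])
  have "y \<ominus>\<^bsub>F\<^esub> x \<in> U"
    using U.a_rcos_module_imp[OF x y] by (simp add: a_minus_def)
  then have "eval_pairs y \<ominus>\<^bsub>P\<^esub> eval_pairs x = \<zero>\<^bsub>P\<^esub>"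
    using tensor_rel_subset_kernel by (auto simp: a_kernel_def' eval_pairs_minus[OF y_closed x])
  then show ?thesis
    using x y_closed P.add.inv_solve_right'[of "\<zero>\<^bsub>P\<^esub>" "eval_pairs y" "eval_pairs x"]
    by (simp add: P.minus_eq lin_maps_closed[OF eval_pairs_lin])
qed

lemma lift_class:
  assumes x: "x \<in> carrier F"
  shows "tensor_lift K P f (tensor_class x) = eval_pairs x"
  unfolding lift_free_eval
proof (rule the_equality)
  show "\<forall>y\<in>tensor_class x. eval_pairs x = eval_pairs y"
    by (intro ballI eval_pairs_representative[OF x, symmetric])
next
  fix v assume "\<forall>y\<in>tensor_class x. v = eval_pairs y"
  then show "v = eval_pairs x"
    using U.a_rcos_self[OF x] by (rule bspec)
qed

lemma lift_lin: "tensor_lift K P f \<in> lin_maps K T P"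
  by (rule lin_mapsI)
    (auto elim!: tensor_carrierE simp: tensor_class_add tensor_class_smult lift_class
      lin_maps_closed[OF eval_pairs_lin] lin_maps_add[OF eval_pairs_lin]
      lin_maps_smult[OF eval_pairs_lin])

lemma lift_pure: "\<lbrakk>m \<in> carrier M; n \<in> carrier N\<rbrakk> \<Longrightarrow> tensor_lift K P f (m \<boxtimes> n) = f m n"
  unfolding pure_tensor_def by (simp add: lift_class eval_pairs_gen free_gen_pair_closed)

end

end

section \<open>Sweedler sums\<close>

syntax "_sweedler_sum" :: "'k \<Rightarrow> 'p \<Rightarrow> pttrn \<Rightarrow> pttrn \<Rightarrow> 't \<Rightarrow> 'c \<Rightarrow> 'c"
  ("(3\<Sum>\<^bsub>_,_\<^esub> _\<otimes>_\<leftarrow>_./ _)" [0, 0, 0, 0, 51, 10] 10)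
translations "\<Sum>\<^bsub>K,P\<^esub> x\<otimes>y\<leftarrow>t. e" \<rightleftharpoons> "CONST tensor_lift K P (\<lambda>x y. e) t"

lemma tensor_lift_record_update: "tensor_lift K (P\<lparr>mult := m, one := u\<rparr>) = tensor_lift K P"
  by (simp add: tensor_lift_def[abs_def] finsum_def)

lemma module_tensor_mod [linear_intros]:
  "\<lbrakk>module K M; module K N\<rbrakk> \<Longrightarrow> module K (tensor_mod K M N)"
  by (rule module_pair.tensor_module[OF module_pair.intro])

lemmas pure_tensor_bilin = module_pair.pure_bilin[OF module_pair.intro]

declare bilin_maps_intros[OF pure_tensor_bilin, linear_intros]

lemma tensor_ext:
  assumes "t \<in> carrier (tensor_mod K M N)"
    and "f \<in> lin_maps K (tensor_mod K M N) P" "g \<in> lin_maps K (tensor_mod K M N) P"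
    and "\<And>m n. \<lbrakk>m \<in> carrier M; n \<in> carrier N\<rbrakk>
      \<Longrightarrow> f (pure_tensor K M N m n) = g (pure_tensor K M N m n)"
    and "module K M" "module K N"
  shows "f t = g t"
  by (rule module_pair.lin_maps_ext[OF module_pair.intro[OF assms(5,6)] assms(1-4)])

lemma tensor_lift_cong:
  "\<lbrakk>t \<in> carrier (tensor_mod K M N); \<And>m n. \<lbrakk>m \<in> carrier M; n \<in> carrier N\<rbrakk> \<Longrightarrow> f m n = g m n;
    module K M; module K N\<rbrakk>
    \<Longrightarrow> tensor_lift K P f t = tensor_lift K P g t"
  by (rule module_pair.lift_cong[OF module_pair.intro])

lemma tensor_lift_pure:
  "\<lbrakk>f \<in> bilin_maps K M N P; m \<in> carrier M; n \<in> carrier N; module K M; module K N; module K P\<rbrakk>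
    \<Longrightarrow> tensor_lift K P f (pure_tensor K M N m n) = f m n"
  by (rule module_pair.lift_pure[OF module_pair.intro])

lemma tensor_lift_lin_arg [linear_intros]:
  "\<lbrakk>t \<in> lin_maps K L (tensor_mod K M N); f \<in> bilin_maps K M N P; module K M; module K N; module K P\<rbrakk>
    \<Longrightarrow> (\<lambda>x. tensor_lift K P f (t x)) \<in> lin_maps K L P"
  by (rule lin_maps_comp[OF module_pair.lift_lin[OF module_pair.intro]])

lemma tensor_lift_closed [linear_intros]:
  "\<lbrakk>t \<in> carrier (tensor_mod K M N); f \<in> bilin_maps K M N P; module K M; module K N; module K P\<rbrakk>
    \<Longrightarrow> tensor_lift K P f t \<in> carrier P"
  by (rule lin_maps_closed[OF module_pair.lift_lin[OF module_pair.intro]])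

lemma tensor_lift_add:
  "\<lbrakk>s \<in> carrier (tensor_mod K M N); t \<in> carrier (tensor_mod K M N); f \<in> bilin_maps K M N P;
    module K M; module K N; module K P\<rbrakk>
    \<Longrightarrow> tensor_lift K P f (s \<oplus>\<^bsub>tensor_mod K M N\<^esub> t) = tensor_lift K P f s \<oplus>\<^bsub>P\<^esub> tensor_lift K P f t"
  by (rule lin_maps_add[OF module_pair.lift_lin[OF module_pair.intro]])

lemma tensor_lift_lin_param [linear_intros]:
  assumes t: "t \<in> carrier (tensor_mod K M N)"
    and bilin: "\<And>x. x \<in> carrier L \<Longrightarrow> f x \<in> bilin_maps K M N P"
    and lin: "\<And>m n. \<lbrakk>m \<in> carrier M; n \<in> carrier N\<rbrakk> \<Longrightarrow> (\<lambda>x. f x m n) \<in> lin_maps K L P"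
    and L: "module K L" and modules: "module K M" "module K N" "module K P"
  shows "(\<lambda>x. tensor_lift K P (f x) t) \<in> lin_maps K L P"
proof -
  interpret L: module K L by fact
  interpret P: module K P by fact
  interpret module_pair K M N by (rule module_pair.intro) fact+
  note lift = tensor_lift_add[OF _ _ bilin modules] tensor_lift_closed[OF _ bilin modules]
  from t show ?thesis
  proof (induction t rule: pure_induct)
    case (pure m n)
    show ?case
      by (rule lin_maps_cong[OF L lin[OF pure]]) (simp add: tensor_lift_pure[OF bilin pure modules])
  next
    case (add s t)
    show ?case
    proof (rule lin_mapsI)
      fix x y assume xy: "x \<in> carrier L" "y \<in> carrier L"
      then show "tensor_lift K P (f (x \<oplus>\<^bsub>L\<^esub> y)) (s \<oplus>\<^bsub>T\<^esub> t) =
          tensor_lift K P (f x) (s \<oplus>\<^bsub>T\<^esub> t) \<oplus>\<^bsub>P\<^esub> tensor_lift K P (f y) (s \<oplus>\<^bsub>T\<^esub> t)"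
        using add(1,2) lin_maps_add[OF add(3) xy] lin_maps_add[OF add(4) xy]
        by (simp add: lift P.a_ac)
    next
      fix c x assume cx: "c \<in> carrier K" "x \<in> carrier L"
      then show "tensor_lift K P (f (c \<odot>\<^bsub>L\<^esub> x)) (s \<oplus>\<^bsub>T\<^esub> t) = c \<odot>\<^bsub>P\<^esub> tensor_lift K P (f x) (s \<oplus>\<^bsub>T\<^esub> t)"
        using add(1,2) lin_maps_smult[OF add(3) cx] lin_maps_smult[OF add(4) cx]
        by (simp add: lift P.smult_r_distr)
    qed (use add(1,2) in \<open>simp add: lift\<close>)
  qed
qed

lemma lin_tensor_lift:
  assumes g: "g \<in> lin_maps K P Q" and t: "t \<in> carrier (tensor_mod K M N)"
    and f: "f \<in> bilin_maps K M N P"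
    and modules [linear_intros]: "module K M" "module K N" "module K P" "module K Q"
  shows "g (\<Sum>\<^bsub>K,P\<^esub> m\<otimes>n\<leftarrow>t. f m n) = (\<Sum>\<^bsub>K,Q\<^esub> m\<otimes>n\<leftarrow>t. g (f m n))"
proof -
  note [linear_intros] = lin_maps_intros[OF g] bilin_maps_intros[OF f]
  show ?thesis
  proof (rule tensor_ext[OF t])
    fix m n assume [linear_intros]: "m \<in> carrier M" "n \<in> carrier N"
    have "tensor_lift K P f (pure_tensor K M N m n) = f m n"
      by (rule tensor_lift_pure) (assumption | rule f linear_intros)+
    moreover have "(\<Sum>\<^bsub>K,Q\<^esub> m\<otimes>n\<leftarrow>pure_tensor K M N m n. g (f m n)) = g (f m n)"
      by (rule tensor_lift_pure) (assumption | rule linear_intros)+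
    ultimately show "g (tensor_lift K P f (pure_tensor K M N m n)) =
        (\<Sum>\<^bsub>K,Q\<^esub> m\<otimes>n\<leftarrow>pure_tensor K M N m n. g (f m n))"
      by simp
  qed (assumption | rule linear_intros)+
qed

lemma lin_tensor_lift2:
  assumes g: "g \<in> lin_maps K P Q" and s: "s \<in> carrier (tensor_mod K L L')"
    and t: "\<And>x y. \<lbrakk>x \<in> carrier L; y \<in> carrier L'\<rbrakk> \<Longrightarrow> t x y \<in> carrier (tensor_mod K M N)"
    and outer: "(\<lambda>x y. \<Sum>\<^bsub>K,P\<^esub> m\<otimes>n\<leftarrow>t x y. f x y m n) \<in> bilin_maps K L L' P"
    and inner: "\<And>x y. \<lbrakk>x \<in> carrier L; y \<in> carrier L'\<rbrakk> \<Longrightarrow> f x y \<in> bilin_maps K M N P"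
    and modules: "module K L" "module K L'" "module K M" "module K N" "module K P" "module K Q"
  shows "g (\<Sum>\<^bsub>K,P\<^esub> x\<otimes>y\<leftarrow>s. \<Sum>\<^bsub>K,P\<^esub> m\<otimes>n\<leftarrow>t x y. f x y m n) =
    (\<Sum>\<^bsub>K,Q\<^esub> x\<otimes>y\<leftarrow>s. \<Sum>\<^bsub>K,Q\<^esub> m\<otimes>n\<leftarrow>t x y. g (f x y m n))"
proof -
  have "g (\<Sum>\<^bsub>K,P\<^esub> x\<otimes>y\<leftarrow>s. \<Sum>\<^bsub>K,P\<^esub> m\<otimes>n\<leftarrow>t x y. f x y m n) =
      (\<Sum>\<^bsub>K,Q\<^esub> x\<otimes>y\<leftarrow>s. g (\<Sum>\<^bsub>K,P\<^esub> m\<otimes>n\<leftarrow>t x y. f x y m n))"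
    by (rule lin_tensor_lift[OF g s outer]) (rule modules)+
  also have "\<dots> = (\<Sum>\<^bsub>K,Q\<^esub> x\<otimes>y\<leftarrow>s. \<Sum>\<^bsub>K,Q\<^esub> m\<otimes>n\<leftarrow>t x y. g (f x y m n))"
    using modules by (intro tensor_lift_cong[OF s] lin_tensor_lift[OF g t inner])
  finally show ?thesis .
qed

lemma bilin_tensor_lift:
  assumes \<mu>: "\<mu> \<in> bilin_maps K P Q R"
    and s: "s \<in> carrier (tensor_mod K M N)" and t: "t \<in> carrier (tensor_mod K M' N')"
    and f: "f \<in> bilin_maps K M N P" and g: "g \<in> bilin_maps K M' N' Q"
    and modules: "module K M" "module K N" "module K M'" "module K N'"
      "module K P" "module K Q" "module K R"
  shows "\<mu> (tensor_lift K P f s) (tensor_lift K Q g t) =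
    (\<Sum>\<^bsub>K,R\<^esub> m\<otimes>n\<leftarrow>s. \<Sum>\<^bsub>K,R\<^esub> m'\<otimes>n'\<leftarrow>t. \<mu> (f m n) (g m' n'))"
proof -
  have "\<mu> (tensor_lift K P f s) (tensor_lift K Q g t) =
      (\<Sum>\<^bsub>K,R\<^esub> m\<otimes>n\<leftarrow>s. \<mu> (f m n) (tensor_lift K Q g t))"
    by (rule lin_tensor_lift[OF bilin_maps_left[OF \<mu>] s f]) (rule linear_intros t g modules)+
  also have "\<dots> = (\<Sum>\<^bsub>K,R\<^esub> m\<otimes>n\<leftarrow>s. \<Sum>\<^bsub>K,R\<^esub> m'\<otimes>n'\<leftarrow>t. \<mu> (f m n) (g m' n'))"
    using modules
    by (intro tensor_lift_cong[OF s] lin_tensor_lift[OF bilin_maps_right[OF \<mu>] t g]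
        bilin_maps_closed[OF f])
  finally show ?thesis .
qed

lemma tensor_lift_lift_pure:
  assumes t: "t \<in> carrier (tensor_mod K M N)" and f: "f \<in> bilin_maps K M' N' P"
    and gh: "(\<lambda>m n. pure_tensor K M' N' (g m n) (h m n)) \<in> bilin_maps K M N (tensor_mod K M' N')"
    and closed: "\<And>m n. \<lbrakk>m \<in> carrier M; n \<in> carrier N\<rbrakk> \<Longrightarrow> g m n \<in> carrier M'"
      "\<And>m n. \<lbrakk>m \<in> carrier M; n \<in> carrier N\<rbrakk> \<Longrightarrow> h m n \<in> carrier N'"
    and modules: "module K M" "module K N" "module K M'" "module K N'" "module K P"
  shows "tensor_lift K P f (\<Sum>\<^bsub>K,tensor_mod K M' N'\<^esub> m\<otimes>n\<leftarrow>t. pure_tensor K M' N' (g m n) (h m n)) =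
    (\<Sum>\<^bsub>K,P\<^esub> m\<otimes>n\<leftarrow>t. f (g m n) (h m n))"
proof -
  have "tensor_lift K P f (\<Sum>\<^bsub>K,tensor_mod K M' N'\<^esub> m\<otimes>n\<leftarrow>t. pure_tensor K M' N' (g m n) (h m n)) =
      (\<Sum>\<^bsub>K,P\<^esub> m\<otimes>n\<leftarrow>t. tensor_lift K P f (pure_tensor K M' N' (g m n) (h m n)))"
    by (rule lin_tensor_lift[OF _ t gh]) (rule linear_intros f modules)+
  also have "\<dots> = (\<Sum>\<^bsub>K,P\<^esub> m\<otimes>n\<leftarrow>t. f (g m n) (h m n))"
    using modules closed by (intro tensor_lift_cong[OF t] tensor_lift_pure[OF f])
  finally show ?thesis .
qed

lemma tensor_lift_lift_pure2:
  assumes s: "s \<in> carrier (tensor_mod K L L')"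
    and t: "\<And>x y. \<lbrakk>x \<in> carrier L; y \<in> carrier L'\<rbrakk> \<Longrightarrow> t x y \<in> carrier (tensor_mod K M N)"
    and f: "f \<in> bilin_maps K M' N' P"
    and outer: "(\<lambda>x y. \<Sum>\<^bsub>K,tensor_mod K M' N'\<^esub> m\<otimes>n\<leftarrow>t x y. pure_tensor K M' N' (g x y m n) (h x y m n))
      \<in> bilin_maps K L L' (tensor_mod K M' N')"
    and inner: "\<And>x y. \<lbrakk>x \<in> carrier L; y \<in> carrier L'\<rbrakk>
      \<Longrightarrow> (\<lambda>m n. pure_tensor K M' N' (g x y m n) (h x y m n)) \<in> bilin_maps K M N (tensor_mod K M' N')"
    and closed:
      "\<And>x y m n. \<lbrakk>x \<in> carrier L; y \<in> carrier L'; m \<in> carrier M; n \<in> carrier N\<rbrakk>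
        \<Longrightarrow> g x y m n \<in> carrier M'"
      "\<And>x y m n. \<lbrakk>x \<in> carrier L; y \<in> carrier L'; m \<in> carrier M; n \<in> carrier N\<rbrakk>
        \<Longrightarrow> h x y m n \<in> carrier N'"
    and modules: "module K L" "module K L'" "module K M" "module K N"
      "module K M'" "module K N'" "module K P"
  shows "tensor_lift K P f (\<Sum>\<^bsub>K,tensor_mod K M' N'\<^esub> x\<otimes>y\<leftarrow>s.
      \<Sum>\<^bsub>K,tensor_mod K M' N'\<^esub> m\<otimes>n\<leftarrow>t x y. pure_tensor K M' N' (g x y m n) (h x y m n)) =
    (\<Sum>\<^bsub>K,P\<^esub> x\<otimes>y\<leftarrow>s. \<Sum>\<^bsub>K,P\<^esub> m\<otimes>n\<leftarrow>t x y. f (g x y m n) (h x y m n))"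
    (is "tensor_lift K P f (tensor_lift K _ ?inner s) = _")
proof -
  have "tensor_lift K P f (tensor_lift K (tensor_mod K M' N') ?inner s) =
      (\<Sum>\<^bsub>K,P\<^esub> x\<otimes>y\<leftarrow>s. tensor_lift K P f (?inner x y))"
    by (rule lin_tensor_lift[OF _ s outer]) (rule linear_intros f modules)+
  also have "\<dots> = (\<Sum>\<^bsub>K,P\<^esub> x\<otimes>y\<leftarrow>s. \<Sum>\<^bsub>K,P\<^esub> m\<otimes>n\<leftarrow>t x y. f (g x y m n) (h x y m n))"
    using modules closed by (intro tensor_lift_cong[OF s] tensor_lift_lift_pure[OF t f inner])
  finally show ?thesis .
qed

lemma tensor_lift_swap:
  assumes s: "s \<in> carrier (tensor_mod K M N)" and t: "t \<in> carrier (tensor_mod K M' N')"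
    and inner: "\<And>m n. \<lbrakk>m \<in> carrier M; n \<in> carrier N\<rbrakk> \<Longrightarrow> f m n \<in> bilin_maps K M' N' P"
    and outer: "\<And>m' n'. \<lbrakk>m' \<in> carrier M'; n' \<in> carrier N'\<rbrakk> \<Longrightarrow> (\<lambda>m n. f m n m' n') \<in> bilin_maps K M N P"
    and modules [linear_intros]:
      "module K M" "module K N" "module K M'" "module K N'" "module K P"
  shows "(\<Sum>\<^bsub>K,P\<^esub> m\<otimes>n\<leftarrow>s. \<Sum>\<^bsub>K,P\<^esub> m'\<otimes>n'\<leftarrow>t. f m n m' n') =
    (\<Sum>\<^bsub>K,P\<^esub> m'\<otimes>n'\<leftarrow>t. \<Sum>\<^bsub>K,P\<^esub> m\<otimes>n\<leftarrow>s. f m n m' n')"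
proof -
  note [linear_intros] = t bilin_maps_intros[OF inner] bilin_maps_intros[OF outer]
  have lift_t: "(\<lambda>m n. \<Sum>\<^bsub>K,P\<^esub> m'\<otimes>n'\<leftarrow>t. f m n m' n') \<in> bilin_maps K M N P"
    by (assumption | rule linear_intros)+
  show ?thesis
  proof (rule tensor_ext[OF s])
    fix m n assume mn: "m \<in> carrier M" "n \<in> carrier N"
    have "(\<Sum>\<^bsub>K,P\<^esub> m\<otimes>n\<leftarrow>pure_tensor K M N m n. \<Sum>\<^bsub>K,P\<^esub> m'\<otimes>n'\<leftarrow>t. f m n m' n') = tensor_lift K P (f m n) t"
      by (rule tensor_lift_pure[OF lift_t mn]) (rule modules)+
    also have "\<dots> = (\<Sum>\<^bsub>K,P\<^esub> m'\<otimes>n'\<leftarrow>t. \<Sum>\<^bsub>K,P\<^esub> m\<otimes>n\<leftarrow>pure_tensor K M N m n. f m n m' n')"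
      using modules mn by (intro tensor_lift_cong[OF t]) (simp_all add: tensor_lift_pure[OF outer])
    finally show "(\<Sum>\<^bsub>K,P\<^esub> m\<otimes>n\<leftarrow>pure_tensor K M N m n. \<Sum>\<^bsub>K,P\<^esub> m'\<otimes>n'\<leftarrow>t. f m n m' n') = \<dots>" .
  qed (assumption | rule linear_intros)+
qed

section \<open>Coassociativity\<close>

context
  fixes K :: "('k, 'x) ring_scheme" and M :: "('k, 'a, 'y) module_scheme"
    and N :: "('k, 'b, 'z) module_scheme" and L :: "('k, 'c, 'w) module_scheme"
  assumes modules [linear_intros]: "module K M" "module K N" "module K L"
begin

lemma tensor_assoc_lin:
  "tensor_assoc K M N L \<in>
    lin_maps K (tensor_mod K (tensor_mod K M N) L) (tensor_mod K M (tensor_mod K N L))"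
  unfolding tensor_assoc_def Let_def by (assumption | rule linear_intros)+

lemma tensor_assoc_pure:
  assumes [linear_intros]: "m \<in> carrier M" "n \<in> carrier N" "l \<in> carrier L"
  shows "tensor_assoc K M N L (pure_tensor K (tensor_mod K M N) L (pure_tensor K M N m n) l) =
    pure_tensor K M (tensor_mod K N L) m (pure_tensor K N L n l)"
proof -
  let ?p = "\<lambda>m n l. pure_tensor K M (tensor_mod K N L) m (pure_tensor K N L n l)"
  let ?T = "tensor_mod K M (tensor_mod K N L)"
  have "tensor_assoc K M N L (pure_tensor K (tensor_mod K M N) L (pure_tensor K M N m n) l) =
      (\<Sum>\<^bsub>K,?T\<^esub> m'\<otimes>n'\<leftarrow>pure_tensor K M N m n. ?p m' n' l)"
    unfolding tensor_assoc_def Let_def by (rule tensor_lift_pure) (assumption | rule linear_intros)+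
  also have "\<dots> = ?p m n l"
    by (rule tensor_lift_pure) (assumption | rule linear_intros)+
  finally show ?thesis .
qed

lemma tensor_lift_tensor_assoc:
  assumes t: "t \<in> carrier (tensor_mod K (tensor_mod K M N) L)"
    and f_left: "\<And>l. l \<in> carrier L \<Longrightarrow> (\<lambda>m n. f m n l) \<in> bilin_maps K M N P"
    and f_right: "\<And>m. m \<in> carrier M \<Longrightarrow> f m \<in> bilin_maps K N L P"
    and P [linear_intros]: "module K P"
  shows "(\<Sum>\<^bsub>K,P\<^esub> m\<otimes>u\<leftarrow>tensor_assoc K M N L t. \<Sum>\<^bsub>K,P\<^esub> n\<otimes>l\<leftarrow>u. f m n l) =
    (\<Sum>\<^bsub>K,P\<^esub> u\<otimes>l\<leftarrow>t. \<Sum>\<^bsub>K,P\<^esub> m\<otimes>n\<leftarrow>u. f m n l)"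
proof -
  note [linear_intros] = f_left f_right bilin_maps_intros[OF f_left] bilin_maps_intros[OF f_right]
    lin_maps_intros[OF tensor_assoc_lin]
  let ?MN = "pure_tensor K M N" and ?MN_L = "pure_tensor K (tensor_mod K M N) L"
  let ?right = "\<lambda>m u. \<Sum>\<^bsub>K,P\<^esub> n\<otimes>l\<leftarrow>u. f m n l" and ?left = "\<lambda>u l. \<Sum>\<^bsub>K,P\<^esub> m\<otimes>n\<leftarrow>u. f m n l"
  show ?thesis
  proof (rule tensor_ext[OF t])
    fix u l assume u: "u \<in> carrier (tensor_mod K M N)" and l [linear_intros]: "l \<in> carrier L"
    show "tensor_lift K P ?right (tensor_assoc K M N L (?MN_L u l)) = tensor_lift K P ?left (?MN_L u l)"
    proof (rule tensor_ext[OF u])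
      fix m n assume mn [linear_intros]: "m \<in> carrier M" "n \<in> carrier N"
      have "tensor_lift K P ?right (tensor_assoc K M N L (?MN_L (?MN m n) l)) =
          tensor_lift K P ?right (pure_tensor K M (tensor_mod K N L) m (pure_tensor K N L n l))"
        by (simp only: tensor_assoc_pure[OF mn l])
      also have "\<dots> = ?right m (pure_tensor K N L n l)"
        by (rule tensor_lift_pure) (assumption | rule linear_intros)+
      also have "\<dots> = f m n l"
        by (rule tensor_lift_pure) (assumption | rule linear_intros)+
      also have "\<dots> = ?left (?MN m n) l"
        by (rule tensor_lift_pure[symmetric]) (assumption | rule linear_intros)+
      also have "\<dots> = tensor_lift K P ?left (?MN_L (?MN m n) l)"
        by (rule tensor_lift_pure[symmetric]) (assumption | rule linear_intros)+
      finally show "tensor_lift K P ?right (tensor_assoc K M N L (?MN_L (?MN m n) l)) =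
          tensor_lift K P ?left (?MN_L (?MN m n) l)" .
    qed (assumption | rule linear_intros)+
  qed (assumption | rule linear_intros)+
qed

end

lemma tensor_lift_coassoc:
  assumes c: "c \<in> carrier C"
    and \<delta>: "\<delta> \<in> lin_maps K C (tensor_mod K C H)" and \<Delta>: "\<Delta> \<in> lin_maps K H (tensor_mod K H H)"
    and coassoc: "tensor_assoc K C H H
        (\<Sum>\<^bsub>K,tensor_mod K (tensor_mod K C H) H\<^esub> x\<otimes>y\<leftarrow>\<delta> c. pure_tensor K (tensor_mod K C H) H (\<delta> x) y) =
      (\<Sum>\<^bsub>K,tensor_mod K C (tensor_mod K H H)\<^esub> x\<otimes>y\<leftarrow>\<delta> c. pure_tensor K C (tensor_mod K H H) x (\<Delta> y))"
    and f_left: "\<And>z. z \<in> carrier H \<Longrightarrow> (\<lambda>x y. f x y z) \<in> bilin_maps K C H P"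
    and f_right: "\<And>x. x \<in> carrier C \<Longrightarrow> f x \<in> bilin_maps K H H P"
    and modules [linear_intros]: "module K C" "module K H" "module K P"
  shows "(\<Sum>\<^bsub>K,P\<^esub> x\<otimes>z\<leftarrow>\<delta> c. \<Sum>\<^bsub>K,P\<^esub> x0\<otimes>x1\<leftarrow>\<delta> x. f x0 x1 z) =
    (\<Sum>\<^bsub>K,P\<^esub> x\<otimes>y\<leftarrow>\<delta> c. \<Sum>\<^bsub>K,P\<^esub> y0\<otimes>y1\<leftarrow>\<Delta> y. f x y0 y1)"
proof -
  note [linear_intros] = c f_left f_right bilin_maps_intros[OF f_left] bilin_maps_intros[OF f_right]
    lin_maps_intros[OF \<delta>] lin_maps_intros[OF \<Delta>]
  let ?left = "\<lambda>u z. \<Sum>\<^bsub>K,P\<^esub> x0\<otimes>x1\<leftarrow>u. f x0 x1 z" and ?right = "\<lambda>x u. \<Sum>\<^bsub>K,P\<^esub> y0\<otimes>y1\<leftarrow>u. f x y0 y1"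
  let ?\<delta>id =
    "\<Sum>\<^bsub>K,tensor_mod K (tensor_mod K C H) H\<^esub> x\<otimes>y\<leftarrow>\<delta> c. pure_tensor K (tensor_mod K C H) H (\<delta> x) y"
  let ?id\<Delta> =
    "\<Sum>\<^bsub>K,tensor_mod K C (tensor_mod K H H)\<^esub> x\<otimes>y\<leftarrow>\<delta> c. pure_tensor K C (tensor_mod K H H) x (\<Delta> y)"
  have "(\<Sum>\<^bsub>K,P\<^esub> x\<otimes>z\<leftarrow>\<delta> c. ?left (\<delta> x) z) = tensor_lift K P ?left ?\<delta>id"
    by (rule tensor_lift_lift_pure[symmetric]) (assumption | rule linear_intros)+
  also have "\<dots> = tensor_lift K P ?right (tensor_assoc K C H H ?\<delta>id)"
    by (rule tensor_lift_tensor_assoc[symmetric]) (assumption | rule linear_intros)+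
  also have "\<dots> = tensor_lift K P ?right ?id\<Delta>"
    by (simp only: coassoc)
  also have "\<dots> = (\<Sum>\<^bsub>K,P\<^esub> x\<otimes>y\<leftarrow>\<delta> c. ?right x (\<Delta> y))"
    by (rule tensor_lift_lift_pure) (assumption | rule linear_intros)+
  finally show ?thesis .
qed

section \<open>Twisted tensor products of algebras\<close>

lemma (in assoc_algebra) mult_bilin: "mult A \<in> bilin_maps K A A A"
  by (intro bilin_mapsI lin_mapsI) (auto simp: A.l_distr A.r_distr smult_mult_left smult_mult_right)

lemmas (in assoc_algebra) [linear_intros] =
  module_axioms A.one_closed bilin_maps_intros[OF mult_bilin] lin_maps_intros[OF smult_lin]

lemma assoc_algebra_moduleI:
  assumes K: "field K" and M: "module K M" and \<mu>: "\<mu> \<in> bilin_maps K M M M" and u: "u \<in> carrier M"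
    and assoc: "\<And>x y z. \<lbrakk>x \<in> carrier M; y \<in> carrier M; z \<in> carrier M\<rbrakk> \<Longrightarrow> \<mu> (\<mu> x y) z = \<mu> x (\<mu> y z)"
    and unit: "\<And>x. x \<in> carrier M \<Longrightarrow> \<mu> u x = x" "\<And>x. x \<in> carrier M \<Longrightarrow> \<mu> x u = x"
  shows "assoc_algebra K (M\<lparr>mult := \<mu>, one := u\<rparr>)" (is "assoc_algebra K ?R")
proof -
  interpret K: field K by fact
  interpret M: module K M by fact
  note bilin = lin_maps_add[OF bilin_maps_left[OF \<mu>]] lin_maps_add[OF bilin_maps_right[OF \<mu>]]
    lin_maps_smult[OF bilin_maps_left[OF \<mu>]] lin_maps_smult[OF bilin_maps_right[OF \<mu>]]
  have abelian: "abelian_group ?R"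
    using M.a_comm_group by (intro comm_group_abelian_groupI) simp
  have "module K ?R"
    by (rule moduleI)
      (simp_all add: K.is_cring abelian M.smult_l_distr M.smult_r_distr M.smult_assoc1)
  moreover have "ring ?R"
  proof (rule ringI)
    show "Group.monoid ?R"
      by (rule monoidI) (simp_all add: bilin_maps_closed[OF \<mu>] u assoc unit)
  qed (simp_all add: abelian bilin)
  ultimately show ?thesis
    by (intro assoc_algebra.intro assoc_algebra_axioms.intro K.field_axioms) (simp_all add: bilin)
qed

locale algebra_pair = A: assoc_algebra K A + B: assoc_algebra K B + module_pair K A B
  for K :: "('k, 'x) ring_scheme" and A :: "('k, 'a, 'y) module_scheme"
    and B :: "('k, 'b, 'z) module_scheme"
begin

notation pure (infixl "\<boxtimes>" 69)

definition left_mult :: "'a \<Rightarrow> ('a \<times> 'b \<Rightarrow> 'k) set \<Rightarrow> ('a \<times> 'b \<Rightarrow> 'k) set" (infixr "\<rightharpoonup>" 67) where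
  "a \<rightharpoonup> t = (\<Sum>\<^bsub>K,T\<^esub> x\<otimes>y\<leftarrow>t. a \<otimes>\<^bsub>A\<^esub> x \<boxtimes> y)"

definition right_mult :: "('a \<times> 'b \<Rightarrow> 'k) set \<Rightarrow> 'b \<Rightarrow> ('a \<times> 'b \<Rightarrow> 'k) set" (infixl "\<leftharpoonup>" 68) where
  "t \<leftharpoonup> b = (\<Sum>\<^bsub>K,T\<^esub> x\<otimes>y\<leftarrow>t. x \<boxtimes> y \<otimes>\<^bsub>B\<^esub> b)"

lemma left_mult_bilin: "(\<rightharpoonup>) \<in> bilin_maps K A T T"
  and right_mult_bilin: "(\<leftharpoonup>) \<in> bilin_maps K T B T"
  unfolding left_mult_def right_mult_def by (assumption | rule linear_intros)+

lemmas [linear_intros] =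
  bilin_maps_intros[OF left_mult_bilin] bilin_maps_intros[OF right_mult_bilin]

lemmas left_mult_closed [simp] = bilin_maps_closed[OF left_mult_bilin]
lemmas right_mult_closed [simp] = bilin_maps_closed[OF right_mult_bilin]

lemma left_mult_pure [simp]:
  assumes [linear_intros]: "a \<in> carrier A" "x \<in> carrier A" "y \<in> carrier B"
  shows "a \<rightharpoonup> x \<boxtimes> y = a \<otimes>\<^bsub>A\<^esub> x \<boxtimes> y"
  unfolding left_mult_def by (rule tensor_lift_pure) (assumption | rule linear_intros)+

lemma right_mult_pure [simp]:
  assumes [linear_intros]: "x \<in> carrier A" "y \<in> carrier B" "b \<in> carrier B"
  shows "x \<boxtimes> y \<leftharpoonup> b = x \<boxtimes> y \<otimes>\<^bsub>B\<^esub> b"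
  unfolding right_mult_def by (rule tensor_lift_pure) (assumption | rule linear_intros)+

lemma left_mult_mult:
  assumes [simp, linear_intros]: "a \<in> carrier A" "b \<in> carrier A" and t: "t \<in> carrier T"
  shows "a \<otimes>\<^bsub>A\<^esub> b \<rightharpoonup> t = a \<rightharpoonup> b \<rightharpoonup> t"
  by (rule lin_maps_ext[OF t]) (simp add: A.A.m_assoc | assumption | rule linear_intros)+

lemma right_mult_mult:
  assumes [simp, linear_intros]: "b \<in> carrier B" "d \<in> carrier B" and t: "t \<in> carrier T"
  shows "t \<leftharpoonup> b \<otimes>\<^bsub>B\<^esub> d = t \<leftharpoonup> b \<leftharpoonup> d"
  by (rule lin_maps_ext[OF t]) (simp add: B.A.m_assoc | assumption | rule linear_intros)+

lemma left_right_mult: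
  assumes [simp, linear_intros]: "a \<in> carrier A" "b \<in> carrier B" and t: "t \<in> carrier T"
  shows "(a \<rightharpoonup> t) \<leftharpoonup> b = a \<rightharpoonup> t \<leftharpoonup> b"
  by (rule lin_maps_ext[OF t]) (simp | assumption | rule linear_intros)+

lemma left_mult_one:
  assumes t: "t \<in> carrier T"
  shows "\<one>\<^bsub>A\<^esub> \<rightharpoonup> t = t"
  by (rule lin_maps_ext[OF t]) (simp | assumption | rule linear_intros)+

lemma right_mult_one:
  assumes t: "t \<in> carrier T"
  shows "t \<leftharpoonup> \<one>\<^bsub>B\<^esub> = t"
  by (rule lin_maps_ext[OF t]) (simp | assumption | rule linear_intros)+

end

locale twisting_map = algebra_pair K A B
  for K :: "('k, 'x) ring_scheme" and A :: "('k, 'a, 'y) module_scheme"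
    and B :: "('k, 'b, 'z) module_scheme" +
  fixes \<tau> :: "'b \<Rightarrow> 'a \<Rightarrow> ('a \<times> 'b \<Rightarrow> 'k) set"
  assumes twist_bilin: "\<tau> \<in> bilin_maps K B A T"
    and twist_one_left: "a \<in> carrier A \<Longrightarrow> \<tau> \<one>\<^bsub>B\<^esub> a = a \<boxtimes> \<one>\<^bsub>B\<^esub>"
    and twist_one_right: "b \<in> carrier B \<Longrightarrow> \<tau> b \<one>\<^bsub>A\<^esub> = \<one>\<^bsub>A\<^esub> \<boxtimes> b"
    and twist_mult_left: "\<lbrakk>b \<in> carrier B; d \<in> carrier B; a \<in> carrier A\<rbrakk>
      \<Longrightarrow> \<tau> (b \<otimes>\<^bsub>B\<^esub> d) a = (\<Sum>\<^bsub>K,T\<^esub> u\<otimes>v\<leftarrow>\<tau> d a. \<tau> b u \<leftharpoonup> v)"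
    and twist_mult_right: "\<lbrakk>b \<in> carrier B; a \<in> carrier A; c \<in> carrier A\<rbrakk>
      \<Longrightarrow> \<tau> b (a \<otimes>\<^bsub>A\<^esub> c) = (\<Sum>\<^bsub>K,T\<^esub> x\<otimes>y\<leftarrow>\<tau> b a. x \<rightharpoonup> \<tau> y c)"
begin

lemmas [linear_intros] = bilin_maps_intros[OF twist_bilin]
lemmas twist_closed [simp] = bilin_maps_closed[OF twist_bilin]

end

locale twisted_tensor_product = twisting_map K A B \<tau>
  for K :: "('k, 'x) ring_scheme" and A :: "('k, 'a, 'y) module_scheme"
    and B :: "('k, 'b, 'z) module_scheme" and \<tau> :: "'b \<Rightarrow> 'a \<Rightarrow> ('a \<times> 'b \<Rightarrow> 'k) set" +
  fixes \<mu> :: "('a \<times> 'b \<Rightarrow> 'k) set \<Rightarrow> ('a \<times> 'b \<Rightarrow> 'k) set \<Rightarrow> ('a \<times> 'b \<Rightarrow> 'k) set" (infixl "\<star>" 66)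
  assumes twisted_mult_bilin: "\<mu> \<in> bilin_maps K T T T"
    and twisted_mult_pure: "\<lbrakk>a \<in> carrier A; b \<in> carrier B; c \<in> carrier A; d \<in> carrier B\<rbrakk>
      \<Longrightarrow> a \<boxtimes> b \<star> c \<boxtimes> d = a \<rightharpoonup> \<tau> b c \<leftharpoonup> d"
begin

lemmas [linear_intros] = bilin_maps_intros[OF twisted_mult_bilin]
lemmas twisted_mult_closed [simp] = bilin_maps_closed[OF twisted_mult_bilin]

lemma left_mult_twisted_mult:
  assumes [simp, linear_intros]: "a \<in> carrier A"
    and s: "s \<in> carrier T" and t [linear_intros]: "t \<in> carrier T"
  shows "(a \<rightharpoonup> s) \<star> t = a \<rightharpoonup> (s \<star> t)"
proof (rule lin_maps_ext[OF s])
  fix x y assume [simp, linear_intros]: "x \<in> carrier A" "y \<in> carrier B"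
  show "(a \<rightharpoonup> x \<boxtimes> y) \<star> t = a \<rightharpoonup> (x \<boxtimes> y \<star> t)"
    by (rule lin_maps_ext[OF t])
      (simp add: twisted_mult_pure left_mult_mult | assumption | rule linear_intros)+
qed (assumption | rule linear_intros)+

lemma twisted_mult_right_mult:
  assumes s: "s \<in> carrier T" and t [linear_intros]: "t \<in> carrier T"
    and [simp, linear_intros]: "b \<in> carrier B"
  shows "s \<star> (t \<leftharpoonup> b) = (s \<star> t) \<leftharpoonup> b"
proof (rule lin_maps_ext[OF s])
  fix x y assume [simp, linear_intros]: "x \<in> carrier A" "y \<in> carrier B"
  show "x \<boxtimes> y \<star> (t \<leftharpoonup> b) = (x \<boxtimes> y \<star> t) \<leftharpoonup> b"
    by (rule lin_maps_ext[OF t])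
      (simp add: twisted_mult_pure right_mult_mult left_right_mult | assumption | rule linear_intros)+
qed (assumption | rule linear_intros)+

lemma pure_twisted_mult:
  assumes [simp, linear_intros]: "a \<in> carrier A" "b \<in> carrier B" and t: "t \<in> carrier T"
  shows "a \<boxtimes> b \<star> t = a \<rightharpoonup> (\<Sum>\<^bsub>K,T\<^esub> u\<otimes>v\<leftarrow>t. \<tau> b u \<leftharpoonup> v)"
proof (rule lin_maps_ext[OF t])
  fix u v assume [simp, linear_intros]: "u \<in> carrier A" "v \<in> carrier B"
  have "(\<Sum>\<^bsub>K,T\<^esub> u\<otimes>v\<leftarrow>u \<boxtimes> v. \<tau> b u \<leftharpoonup> v) = \<tau> b u \<leftharpoonup> v"
    by (rule tensor_lift_pure) (assumption | rule linear_intros)+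
  then show "a \<boxtimes> b \<star> u \<boxtimes> v = a \<rightharpoonup> (\<Sum>\<^bsub>K,T\<^esub> u\<otimes>v\<leftarrow>u \<boxtimes> v. \<tau> b u \<leftharpoonup> v)"
    by (simp add: twisted_mult_pure)
qed (assumption | rule linear_intros)+

lemma twisted_mult_pure_right:
  assumes [simp, linear_intros]: "c \<in> carrier A" "d \<in> carrier B" and s: "s \<in> carrier T"
  shows "s \<star> c \<boxtimes> d = (\<Sum>\<^bsub>K,T\<^esub> x\<otimes>y\<leftarrow>s. x \<rightharpoonup> \<tau> y c) \<leftharpoonup> d"
proof (rule lin_maps_ext[OF s])
  fix x y assume [simp, linear_intros]: "x \<in> carrier A" "y \<in> carrier B"
  have "(\<Sum>\<^bsub>K,T\<^esub> x\<otimes>y\<leftarrow>x \<boxtimes> y. x \<rightharpoonup> \<tau> y c) = x \<rightharpoonup> \<tau> y c"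
    by (rule tensor_lift_pure) (assumption | rule linear_intros)+
  then show "x \<boxtimes> y \<star> c \<boxtimes> d = (\<Sum>\<^bsub>K,T\<^esub> x\<otimes>y\<leftarrow>x \<boxtimes> y. x \<rightharpoonup> \<tau> y c) \<leftharpoonup> d"
    by (simp add: twisted_mult_pure left_right_mult)
qed (assumption | rule linear_intros)+

lemma pure_twisted_mult_left_mult:
  assumes [simp, linear_intros]: "a \<in> carrier A" "b \<in> carrier B" "c \<in> carrier A"
    and t: "t \<in> carrier T"
  shows "a \<boxtimes> b \<star> (c \<rightharpoonup> t) = a \<rightharpoonup> (\<tau> b c \<star> t)"
proof (rule lin_maps_ext[OF t])
  fix u v assume [simp]: "u \<in> carrier A" "v \<in> carrier B"
  have "a \<boxtimes> b \<star> (c \<rightharpoonup> u \<boxtimes> v) = a \<rightharpoonup> \<tau> b (c \<otimes>\<^bsub>A\<^esub> u) \<leftharpoonup> v"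
    by (simp add: twisted_mult_pure)
  also have "\<dots> = a \<rightharpoonup> (\<tau> b c \<star> u \<boxtimes> v)"
    by (simp add: twist_mult_right twisted_mult_pure_right)
  finally show "a \<boxtimes> b \<star> (c \<rightharpoonup> u \<boxtimes> v) = a \<rightharpoonup> (\<tau> b c \<star> u \<boxtimes> v)" .
qed (assumption | rule linear_intros)+

lemma right_mult_twisted_mult_pure:
  assumes [simp, linear_intros]: "d \<in> carrier B" "e \<in> carrier A" "f \<in> carrier B"
    and s: "s \<in> carrier T"
  shows "(s \<leftharpoonup> d) \<star> e \<boxtimes> f = s \<star> (\<tau> d e \<leftharpoonup> f)"
proof (rule lin_maps_ext[OF s])
  fix x y assume [simp, linear_intros]: "x \<in> carrier A" "y \<in> carrier B"
  have "(x \<boxtimes> y \<leftharpoonup> d) \<star> e \<boxtimes> f = x \<rightharpoonup> \<tau> (y \<otimes>\<^bsub>B\<^esub> d) e \<leftharpoonup> f"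
    by (simp add: twisted_mult_pure)
  also have "\<dots> = x \<rightharpoonup> (\<Sum>\<^bsub>K,T\<^esub> u\<otimes>v\<leftarrow>\<tau> d e. \<tau> y u \<leftharpoonup> v) \<leftharpoonup> f"
    by (simp add: twist_mult_left)
  also have "\<dots> = (x \<rightharpoonup> (\<Sum>\<^bsub>K,T\<^esub> u\<otimes>v\<leftarrow>\<tau> d e. \<tau> y u \<leftharpoonup> v)) \<leftharpoonup> f"
    by (rule left_right_mult[symmetric]) (assumption | rule linear_intros)+
  also have "\<dots> = x \<boxtimes> y \<star> (\<tau> d e \<leftharpoonup> f)"
    by (simp add: pure_twisted_mult twisted_mult_right_mult)
  finally show "(x \<boxtimes> y \<leftharpoonup> d) \<star> e \<boxtimes> f = x \<boxtimes> y \<star> (\<tau> d e \<leftharpoonup> f)" .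
qed (assumption | rule linear_intros)+

lemma twisted_mult_assoc:
  assumes r: "r \<in> carrier T" and s [linear_intros]: "s \<in> carrier T"
    and t [linear_intros]: "t \<in> carrier T"
  shows "r \<star> s \<star> t = r \<star> (s \<star> t)"
proof (rule lin_maps_ext[OF r])
  fix a b assume [simp, linear_intros]: "a \<in> carrier A" "b \<in> carrier B"
  show "a \<boxtimes> b \<star> s \<star> t = a \<boxtimes> b \<star> (s \<star> t)"
  proof (rule lin_maps_ext[OF s])
    fix c d assume [simp, linear_intros]: "c \<in> carrier A" "d \<in> carrier B"
    show "a \<boxtimes> b \<star> c \<boxtimes> d \<star> t = a \<boxtimes> b \<star> (c \<boxtimes> d \<star> t)"
    proof (rule lin_maps_ext[OF t])
      fix e f assume [simp]: "e \<in> carrier A" "f \<in> carrier B"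
      have "a \<boxtimes> b \<star> c \<boxtimes> d \<star> e \<boxtimes> f = a \<rightharpoonup> (\<tau> b c \<star> (\<tau> d e \<leftharpoonup> f))"
        by (simp add: twisted_mult_pure left_mult_twisted_mult right_mult_twisted_mult_pure)
      also have "\<dots> = a \<boxtimes> b \<star> (c \<boxtimes> d \<star> e \<boxtimes> f)"
        by (simp add: twisted_mult_pure pure_twisted_mult_left_mult)
      finally show "a \<boxtimes> b \<star> c \<boxtimes> d \<star> e \<boxtimes> f = a \<boxtimes> b \<star> (c \<boxtimes> d \<star> e \<boxtimes> f)" .
    qed (assumption | rule linear_intros)+
  qed (assumption | rule linear_intros)+
qed (assumption | rule linear_intros)+

lemma twisted_mult_one_left:
  assumes t: "t \<in> carrier T"
  shows "\<one>\<^bsub>A\<^esub> \<boxtimes> \<one>\<^bsub>B\<^esub> \<star> t = t"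
  by (rule lin_maps_ext[OF t])
    (simp add: twisted_mult_pure twist_one_left left_mult_one | assumption | rule linear_intros)+

lemma twisted_mult_one_right:
  assumes t: "t \<in> carrier T"
  shows "t \<star> \<one>\<^bsub>A\<^esub> \<boxtimes> \<one>\<^bsub>B\<^esub> = t"
  by (rule lin_maps_ext[OF t])
    (simp add: twisted_mult_pure twist_one_right right_mult_one | assumption | rule linear_intros)+

theorem twisted_tensor_product_assoc_algebra:
  "assoc_algebra K (T\<lparr>mult := (\<star>), one := \<one>\<^bsub>A\<^esub> \<boxtimes> \<one>\<^bsub>B\<^esub>\<rparr>)"
  by (rule assoc_algebra_moduleI[OF A.K.field_axioms tensor_module twisted_mult_bilin])
    (simp_all add: twisted_mult_assoc twisted_mult_one_left twisted_mult_one_right)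

end

section \<open>Tensor products of Hopf modules\<close>

context hopf_algebra
begin

lemmas [linear_intros] = lin_maps_intros[OF comult_lin]
lemmas comult_closed [simp] = lin_maps_closed[OF comult_lin]

lemma comult_cong:
  "\<lbrakk>h \<in> carrier H; \<And>x y. \<lbrakk>x \<in> carrier H; y \<in> carrier H\<rbrakk> \<Longrightarrow> f x y = g x y\<rbrakk>
    \<Longrightarrow> tensor_lift K P f (\<Delta> h) = tensor_lift K P g (\<Delta> h)"
  by (rule tensor_lift_cong) (rule comult_closed module_axioms | assumption | simp)+

lemma counit_closed [simp, linear_intros]: "h \<in> carrier H \<Longrightarrow> \<epsilon> h \<in> carrier K"
  by (rule ring_hom_closed[OF counit_hom])

lemma counit_smult_lin [linear_intros]:
  assumes "module K M" "v \<in> carrier M"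
  shows "(\<lambda>h. \<epsilon> h \<odot>\<^bsub>M\<^esub> v) \<in> lin_maps K H M"
proof -
  interpret M: module K M by fact
  show ?thesis
    using assms(2)
    by (auto intro!: lin_mapsI
        simp: ring_hom_add[OF counit_hom] counit_smult M.smult_l_distr M.smult_assoc1)
qed

lemma comult_mult_lift:
  assumes f: "f \<in> bilin_maps K H H P" and P [linear_intros]: "module K P"
    and [linear_intros]: "g \<in> carrier H" "h \<in> carrier H"
  shows "tensor_lift K P f (\<Delta> (g \<otimes>\<^bsub>H\<^esub> h)) =
    (\<Sum>\<^bsub>K,P\<^esub> g0\<otimes>g1\<leftarrow>\<Delta> g. \<Sum>\<^bsub>K,P\<^esub> h0\<otimes>h1\<leftarrow>\<Delta> h. f (g0 \<otimes>\<^bsub>H\<^esub> h0) (g1 \<otimes>\<^bsub>H\<^esub> h1))"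
  unfolding comult_mult[OF assms(3,4)] tensor_alg_def Let_def
  by simp (rule tensor_lift_lift_pure2, (assumption | rule f linear_intros)+)

lemmas comult_coassoc_lift = tensor_lift_coassoc[OF _ comult_lin comult_lin comult_coassoc]

text \<open>
  Both sides are \<open>f h\<^sub>0 h\<^sub>1 h\<^sub>2 h\<^sub>3\<close>; the bracketing on the right makes the two middle legs the
  comultiplication of a single element.
\<close>

lemma comult_coassoc4:
  assumes h [linear_intros]: "h \<in> carrier H" and P [linear_intros]: "module K P"
    and f_inner: "\<And>x y. \<lbrakk>x \<in> carrier H; y \<in> carrier H\<rbrakk> \<Longrightarrow> f x y \<in> bilin_maps K H H P"
    and f_outer: "\<And>x y. \<lbrakk>x \<in> carrier H; y \<in> carrier H\<rbrakk> \<Longrightarrow> (\<lambda>z w. f z w x y) \<in> bilin_maps K H H P"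
  shows "(\<Sum>\<^bsub>K,P\<^esub> x\<otimes>y\<leftarrow>\<Delta> h. \<Sum>\<^bsub>K,P\<^esub> x0\<otimes>x1\<leftarrow>\<Delta> x. \<Sum>\<^bsub>K,P\<^esub> y0\<otimes>y1\<leftarrow>\<Delta> y. f x0 x1 y0 y1) =
    (\<Sum>\<^bsub>K,P\<^esub> x\<otimes>y\<leftarrow>\<Delta> h. \<Sum>\<^bsub>K,P\<^esub> u\<otimes>v\<leftarrow>\<Delta> y. \<Sum>\<^bsub>K,P\<^esub> u0\<otimes>u1\<leftarrow>\<Delta> u. f x u0 u1 v)"
proof -
  note [linear_intros] = f_inner f_outer bilin_maps_intros[OF f_inner] bilin_maps_intros[OF f_outer]
  have "(\<Sum>\<^bsub>K,P\<^esub> x\<otimes>y\<leftarrow>\<Delta> h. \<Sum>\<^bsub>K,P\<^esub> x0\<otimes>x1\<leftarrow>\<Delta> x. \<Sum>\<^bsub>K,P\<^esub> y0\<otimes>y1\<leftarrow>\<Delta> y. f x0 x1 y0 y1) =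
      (\<Sum>\<^bsub>K,P\<^esub> x\<otimes>y\<leftarrow>\<Delta> h. \<Sum>\<^bsub>K,P\<^esub> u\<otimes>v\<leftarrow>\<Delta> y. \<Sum>\<^bsub>K,P\<^esub> v0\<otimes>v1\<leftarrow>\<Delta> v. f x u v0 v1)"
    by (rule comult_coassoc_lift) (assumption | rule linear_intros)+
  also have "\<dots> = (\<Sum>\<^bsub>K,P\<^esub> x\<otimes>y\<leftarrow>\<Delta> h. \<Sum>\<^bsub>K,P\<^esub> u\<otimes>v\<leftarrow>\<Delta> y. \<Sum>\<^bsub>K,P\<^esub> u0\<otimes>u1\<leftarrow>\<Delta> u. f x u0 u1 v)"
    by (rule comult_cong[OF h], rule comult_coassoc_lift[symmetric]) (assumption | rule linear_intros)+
  finally show ?thesis .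
qed

end

locale left_hopf_module = hopf_algebra K H \<Delta> \<epsilon> S + M: module K M
  for K (structure) and H (structure) and \<Delta> \<epsilon> S and M (structure) +
  fixes act :: "'c \<Rightarrow> 'e \<Rightarrow> 'e"
  assumes act_bilin: "act \<in> bilin_maps K H M M"
    and act_one: "m \<in> carrier M \<Longrightarrow> act \<one>\<^bsub>H\<^esub> m = m"
    and act_mult:
      "\<lbrakk>g \<in> carrier H; h \<in> carrier H; m \<in> carrier M\<rbrakk> \<Longrightarrow> act (g \<otimes>\<^bsub>H\<^esub> h) m = act g (act h m)"
begin

lemmas [linear_intros] = M.module_axioms bilin_maps_intros[OF act_bilin]
lemmas act_closed [simp] = bilin_maps_closed[OF act_bilin]

end

locale left_hopf_module_pair = hopf_algebra K H \<Delta> \<epsilon> S +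
  M: left_hopf_module K H \<Delta> \<epsilon> S M actM + N: left_hopf_module K H \<Delta> \<epsilon> S N actN + module_pair K M N
  for K H \<Delta> \<epsilon> S M actM N actN
begin

notation pure (infixl "\<boxtimes>" 69)

abbreviation "diag \<equiv> diagonal_act K \<Delta> M actM N actN"

lemma diagonal_act_bilin: "diag \<in> bilin_maps K H T T"
  unfolding diagonal_act_def Let_def by (assumption | rule linear_intros)+

lemmas [linear_intros] = bilin_maps_intros[OF diagonal_act_bilin]
lemmas diagonal_act_closed [simp] = bilin_maps_closed[OF diagonal_act_bilin]

lemma diagonal_act_pure:
  assumes [linear_intros]: "h \<in> carrier H" "m \<in> carrier M" "n \<in> carrier N"
  shows "diag h (m \<boxtimes> n) = (\<Sum>\<^bsub>K,T\<^esub> h0\<otimes>h1\<leftarrow>\<Delta> h. actM h0 m \<boxtimes> actN h1 n)"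
  unfolding diagonal_act_def Let_def by (rule tensor_lift_pure) (assumption | rule linear_intros)+

lemma diagonal_act_one:
  assumes t: "t \<in> carrier T"
  shows "diag \<one>\<^bsub>H\<^esub> t = t"
proof (rule lin_maps_ext[OF t])
  fix m n assume [simp, linear_intros]: "m \<in> carrier M" "n \<in> carrier N"
  have "\<Delta> \<one>\<^bsub>H\<^esub> = pure_tensor K H H \<one>\<^bsub>H\<^esub> \<one>\<^bsub>H\<^esub>"
    by (simp add: comult_one tensor_alg_def Let_def)
  then have "diag \<one>\<^bsub>H\<^esub> (m \<boxtimes> n) = (\<Sum>\<^bsub>K,T\<^esub> h0\<otimes>h1\<leftarrow>pure_tensor K H H \<one>\<^bsub>H\<^esub> \<one>\<^bsub>H\<^esub>. actM h0 m \<boxtimes> actN h1 n)"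
    by (simp add: diagonal_act_pure)
  also have "\<dots> = actM \<one>\<^bsub>H\<^esub> m \<boxtimes> actN \<one>\<^bsub>H\<^esub> n"
    by (rule tensor_lift_pure) (assumption | rule linear_intros)+
  finally show "diag \<one>\<^bsub>H\<^esub> (m \<boxtimes> n) = m \<boxtimes> n"
    by (simp add: M.act_one N.act_one)
qed (assumption | rule linear_intros)+

lemma diagonal_act_mult:
  assumes gh [simp, linear_intros]: "g \<in> carrier H" "h \<in> carrier H" and t: "t \<in> carrier T"
  shows "diag (g \<otimes>\<^bsub>H\<^esub> h) t = diag g (diag h t)"
proof (rule lin_maps_ext[OF t])
  fix m n assume mn [simp, linear_intros]: "m \<in> carrier M" "n \<in> carrier N"
  have "diag (g \<otimes>\<^bsub>H\<^esub> h) (m \<boxtimes> n) =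
      (\<Sum>\<^bsub>K,T\<^esub> g0\<otimes>g1\<leftarrow>\<Delta> g. \<Sum>\<^bsub>K,T\<^esub> h0\<otimes>h1\<leftarrow>\<Delta> h. actM (g0 \<otimes>\<^bsub>H\<^esub> h0) m \<boxtimes> actN (g1 \<otimes>\<^bsub>H\<^esub> h1) n)"
    by (simp add: diagonal_act_pure) (rule comult_mult_lift, (assumption | rule linear_intros)+)
  also have "\<dots> =
      (\<Sum>\<^bsub>K,T\<^esub> h0\<otimes>h1\<leftarrow>\<Delta> h. \<Sum>\<^bsub>K,T\<^esub> g0\<otimes>g1\<leftarrow>\<Delta> g. actM (g0 \<otimes>\<^bsub>H\<^esub> h0) m \<boxtimes> actN (g1 \<otimes>\<^bsub>H\<^esub> h1) n)"
    by (rule tensor_lift_swap) (assumption | rule linear_intros)+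
  also have "\<dots> = (\<Sum>\<^bsub>K,T\<^esub> h0\<otimes>h1\<leftarrow>\<Delta> h. diag g (actM h0 m \<boxtimes> actN h1 n))"
    by (intro comult_cong) (simp_all add: diagonal_act_pure M.act_mult N.act_mult cong: comult_cong)
  also have "\<dots> = diag g (diag h (m \<boxtimes> n))"
    unfolding diagonal_act_pure[OF gh(2) mn]
    by (rule lin_tensor_lift[symmetric]) (assumption | rule linear_intros)+
  finally show "diag (g \<otimes>\<^bsub>H\<^esub> h) (m \<boxtimes> n) = diag g (diag h (m \<boxtimes> n))" .
qed (assumption | rule linear_intros)+

theorem diagonal_act_left_hopf_module: "left_hopf_module K H \<Delta> \<epsilon> S T diag"
  by (intro left_hopf_module.intro left_hopf_module_axioms.intro)
    (simp_all add: hopf_algebra_axioms tensor_module diagonal_act_bilin diagonal_act_one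
      diagonal_act_mult)

end

sublocale left_hopf_module_algebra \<subseteq> Mod: left_hopf_module K H \<Delta> \<epsilon> S A act
  by (intro left_hopf_module.intro left_hopf_module_axioms.intro hopf_algebra_axioms Alg.module_axioms
      bilin_mapsI act_lin_left act_lin_right)
    (simp_all add: act_one act_mult)

locale left_hopf_module_algebra_pair = hopf_algebra K H \<Delta> \<epsilon> S +
  A: left_hopf_module_algebra K H \<Delta> \<epsilon> S A actA + B: left_hopf_module_algebra K H \<Delta> \<epsilon> S B actB +
  algebra_pair K A B + left_hopf_module_pair K H \<Delta> \<epsilon> S A actA B actB
  for K H \<Delta> \<epsilon> S A actA B actB
begin

lemma diagonal_act_left_mult:
  assumes h [simp, linear_intros]: "h \<in> carrier H" and [simp, linear_intros]: "a \<in> carrier A"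
    and t: "t \<in> carrier T"
  shows "diag h (a \<rightharpoonup> t) = (\<Sum>\<^bsub>K,T\<^esub> x\<otimes>y\<leftarrow>\<Delta> h. actA x a \<rightharpoonup> diag y t)"
proof (rule lin_maps_ext[OF t])
  fix u v assume [simp, linear_intros]: "u \<in> carrier A" "v \<in> carrier B"
  have "diag h (a \<rightharpoonup> u \<boxtimes> v) = (\<Sum>\<^bsub>K,T\<^esub> x\<otimes>y\<leftarrow>\<Delta> h. actA x (a \<otimes>\<^bsub>A\<^esub> u) \<boxtimes> actB y v)"
    by (simp add: diagonal_act_pure)
  also have "\<dots> = (\<Sum>\<^bsub>K,T\<^esub> x\<otimes>y\<leftarrow>\<Delta> h. \<Sum>\<^bsub>K,T\<^esub> x0\<otimes>x1\<leftarrow>\<Delta> x. actA x0 a \<otimes>\<^bsub>A\<^esub> actA x1 u \<boxtimes> actB y v)"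
    by (rule comult_cong[OF h], simp add: A.act_alg_mult, rule lin_tensor_lift)
      (assumption | rule linear_intros)+
  also have "\<dots> = (\<Sum>\<^bsub>K,T\<^esub> x\<otimes>y\<leftarrow>\<Delta> h. \<Sum>\<^bsub>K,T\<^esub> y0\<otimes>y1\<leftarrow>\<Delta> y. actA x a \<otimes>\<^bsub>A\<^esub> actA y0 u \<boxtimes> actB y1 v)"
    by (rule comult_coassoc_lift) (assumption | rule linear_intros)+
  also have "\<dots> = (\<Sum>\<^bsub>K,T\<^esub> x\<otimes>y\<leftarrow>\<Delta> h. actA x a \<rightharpoonup> diag y (u \<boxtimes> v))"
  proof (rule comult_cong[OF h])
    fix x y assume [simp, linear_intros]: "x \<in> carrier H" "y \<in> carrier H"
    have "actA x a \<rightharpoonup> diag y (u \<boxtimes> v) = (\<Sum>\<^bsub>K,T\<^esub> y0\<otimes>y1\<leftarrow>\<Delta> y. actA x a \<rightharpoonup> actA y0 u \<boxtimes> actB y1 v)"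
      by (simp add: diagonal_act_pure) (rule lin_tensor_lift, (assumption | rule linear_intros)+)
    then show "(\<Sum>\<^bsub>K,T\<^esub> y0\<otimes>y1\<leftarrow>\<Delta> y. actA x a \<otimes>\<^bsub>A\<^esub> actA y0 u \<boxtimes> actB y1 v) = actA x a \<rightharpoonup> diag y (u \<boxtimes> v)"
      by (simp cong: comult_cong)
  qed
  finally show "diag h (a \<rightharpoonup> u \<boxtimes> v) = (\<Sum>\<^bsub>K,T\<^esub> x\<otimes>y\<leftarrow>\<Delta> h. actA x a \<rightharpoonup> diag y (u \<boxtimes> v))" .
qed (assumption | rule linear_intros)+

lemma diagonal_act_right_mult:
  assumes h [simp, linear_intros]: "h \<in> carrier H" and [simp, linear_intros]: "b \<in> carrier B"
    and t: "t \<in> carrier T"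
  shows "diag h (t \<leftharpoonup> b) = (\<Sum>\<^bsub>K,T\<^esub> x\<otimes>y\<leftarrow>\<Delta> h. diag x t \<leftharpoonup> actB y b)"
proof (rule lin_maps_ext[OF t])
  fix u v assume [simp, linear_intros]: "u \<in> carrier A" "v \<in> carrier B"
  have "diag h (u \<boxtimes> v \<leftharpoonup> b) = (\<Sum>\<^bsub>K,T\<^esub> x\<otimes>y\<leftarrow>\<Delta> h. actA x u \<boxtimes> actB y (v \<otimes>\<^bsub>B\<^esub> b))"
    by (simp add: diagonal_act_pure)
  also have "\<dots> = (\<Sum>\<^bsub>K,T\<^esub> x\<otimes>y\<leftarrow>\<Delta> h. \<Sum>\<^bsub>K,T\<^esub> y0\<otimes>y1\<leftarrow>\<Delta> y. actA x u \<boxtimes> actB y0 v \<otimes>\<^bsub>B\<^esub> actB y1 b)"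
    by (rule comult_cong[OF h], simp add: B.act_alg_mult, rule lin_tensor_lift)
      (assumption | rule linear_intros)+
  also have "\<dots> = (\<Sum>\<^bsub>K,T\<^esub> x\<otimes>y\<leftarrow>\<Delta> h. \<Sum>\<^bsub>K,T\<^esub> x0\<otimes>x1\<leftarrow>\<Delta> x. actA x0 u \<boxtimes> actB x1 v \<otimes>\<^bsub>B\<^esub> actB y b)"
    by (rule comult_coassoc_lift[symmetric]) (assumption | rule linear_intros)+
  also have "\<dots> = (\<Sum>\<^bsub>K,T\<^esub> x\<otimes>y\<leftarrow>\<Delta> h. diag x (u \<boxtimes> v) \<leftharpoonup> actB y b)"
  proof (rule comult_cong[OF h])
    fix x y assume [simp, linear_intros]: "x \<in> carrier H" "y \<in> carrier H"
    have "diag x (u \<boxtimes> v) \<leftharpoonup> actB y b = (\<Sum>\<^bsub>K,T\<^esub> x0\<otimes>x1\<leftarrow>\<Delta> x. actA x0 u \<boxtimes> actB x1 v \<leftharpoonup> actB y b)"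
      by (simp add: diagonal_act_pure)
        (rule lin_tensor_lift[of "\<lambda>t. t \<leftharpoonup> actB y b"], (assumption | rule linear_intros)+)
    then show "(\<Sum>\<^bsub>K,T\<^esub> x0\<otimes>x1\<leftarrow>\<Delta> x. actA x0 u \<boxtimes> actB x1 v \<otimes>\<^bsub>B\<^esub> actB y b) = diag x (u \<boxtimes> v) \<leftharpoonup> actB y b"
      by (simp cong: comult_cong)
  qed
  finally show "diag h (u \<boxtimes> v \<leftharpoonup> b) = (\<Sum>\<^bsub>K,T\<^esub> x\<otimes>y\<leftarrow>\<Delta> h. diag x (u \<boxtimes> v) \<leftharpoonup> actB y b)" .
qed (assumption | rule linear_intros)+

lemma diagonal_act_alg_one:
  assumes [simp, linear_intros]: "h \<in> carrier H"
  shows "diag h (\<one>\<^bsub>A\<^esub> \<boxtimes> \<one>\<^bsub>B\<^esub>) = \<epsilon> h \<odot>\<^bsub>T\<^esub> (\<one>\<^bsub>A\<^esub> \<boxtimes> \<one>\<^bsub>B\<^esub>)"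
proof -
  have "diag h (\<one>\<^bsub>A\<^esub> \<boxtimes> \<one>\<^bsub>B\<^esub>) = (\<Sum>\<^bsub>K,T\<^esub> x\<otimes>y\<leftarrow>\<Delta> h. \<one>\<^bsub>A\<^esub> \<boxtimes> actB (\<epsilon> x \<odot>\<^bsub>H\<^esub> y) \<one>\<^bsub>B\<^esub>)"
    by (simp add: diagonal_act_pure A.act_alg_one pure_smult_left pure_smult_right
        lin_maps_smult[OF B.act_lin_left] cong: comult_cong)
  also have "\<dots> = \<one>\<^bsub>A\<^esub> \<boxtimes> actB (\<Sum>\<^bsub>K,H\<^esub> x\<otimes>y\<leftarrow>\<Delta> h. \<epsilon> x \<odot>\<^bsub>H\<^esub> y) \<one>\<^bsub>B\<^esub>"
    by (rule lin_tensor_lift[of "\<lambda>y. \<one>\<^bsub>A\<^esub> \<boxtimes> actB y \<one>\<^bsub>B\<^esub>", symmetric]) (assumption | rule linear_intros)+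
  also have "\<dots> = \<epsilon> h \<odot>\<^bsub>T\<^esub> (\<one>\<^bsub>A\<^esub> \<boxtimes> \<one>\<^bsub>B\<^esub>)"
    by (simp add: counit_left B.act_alg_one pure_smult_right)
  finally show ?thesis .
qed

end

locale equivariant_twisted_tensor_product =
  left_hopf_module_algebra_pair K H \<Delta> \<epsilon> S A actA B actB + twisted_tensor_product K A B \<tau> \<mu>
  for K H \<Delta> \<epsilon> S A actA B actB \<tau> and \<mu> (infixl "\<star>" 66) +
  assumes twist_equivariant: "\<lbrakk>h \<in> carrier H; b \<in> carrier B; a \<in> carrier A\<rbrakk>
      \<Longrightarrow> diag h (\<tau> b a) = (\<Sum>\<^bsub>K,T\<^esub> x\<otimes>y\<leftarrow>\<Delta> h. \<tau> (actB x b) (actA y a))"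
begin

lemma diagonal_act_twisted_mult_pure:
  assumes h [simp, linear_intros]: "h \<in> carrier H"
    and [simp, linear_intros]: "a \<in> carrier A" "b \<in> carrier B" "c \<in> carrier A" "d \<in> carrier B"
  shows "diag h (a \<boxtimes> b \<star> c \<boxtimes> d) = (\<Sum>\<^bsub>K,T\<^esub> x\<otimes>y\<leftarrow>\<Delta> h. diag x (a \<boxtimes> b) \<star> diag y (c \<boxtimes> d))"
proof -
  let ?G = "\<lambda>p q r w. actA p a \<rightharpoonup> \<tau> (actB q b) (actA r c) \<leftharpoonup> actB w d"
  have "diag h (a \<boxtimes> b \<star> c \<boxtimes> d) = (\<Sum>\<^bsub>K,T\<^esub> x\<otimes>y\<leftarrow>\<Delta> h. actA x a \<rightharpoonup> diag y (\<tau> b c \<leftharpoonup> d))"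
    by (simp add: twisted_mult_pure diagonal_act_left_mult)
  also have "\<dots> = (\<Sum>\<^bsub>K,T\<^esub> x\<otimes>y\<leftarrow>\<Delta> h. \<Sum>\<^bsub>K,T\<^esub> u\<otimes>v\<leftarrow>\<Delta> y. \<Sum>\<^bsub>K,T\<^esub> u0\<otimes>u1\<leftarrow>\<Delta> u. ?G x u0 u1 v)"
  proof (rule comult_cong[OF h])
    fix x y assume [simp, linear_intros]: "x \<in> carrier H" "y \<in> carrier H"
    have "diag y (\<tau> b c \<leftharpoonup> d) = (\<Sum>\<^bsub>K,T\<^esub> u\<otimes>v\<leftarrow>\<Delta> y. diag u (\<tau> b c) \<leftharpoonup> actB v d)"
      by (simp add: diagonal_act_right_mult)
    also have "\<dots> = (\<Sum>\<^bsub>K,T\<^esub> u\<otimes>v\<leftarrow>\<Delta> y. \<Sum>\<^bsub>K,T\<^esub> u0\<otimes>u1\<leftarrow>\<Delta> u. \<tau> (actB u0 b) (actA u1 c) \<leftharpoonup> actB v d)"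
      by (rule comult_cong, simp, simp add: twist_equivariant,
          rule lin_tensor_lift[of "\<lambda>t. t \<leftharpoonup> actB _ d"]) (assumption | rule linear_intros)+
    finally show "actA x a \<rightharpoonup> diag y (\<tau> b c \<leftharpoonup> d) =
        (\<Sum>\<^bsub>K,T\<^esub> u\<otimes>v\<leftarrow>\<Delta> y. \<Sum>\<^bsub>K,T\<^esub> u0\<otimes>u1\<leftarrow>\<Delta> u. ?G x u0 u1 v)"
      by simp (rule lin_tensor_lift2, (assumption | rule linear_intros)+)
  qed
  also have "\<dots> = (\<Sum>\<^bsub>K,T\<^esub> x\<otimes>y\<leftarrow>\<Delta> h. \<Sum>\<^bsub>K,T\<^esub> x0\<otimes>x1\<leftarrow>\<Delta> x. \<Sum>\<^bsub>K,T\<^esub> y0\<otimes>y1\<leftarrow>\<Delta> y. ?G x0 x1 y0 y1)"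
    by (rule comult_coassoc4[symmetric]) (assumption | rule linear_intros)+
  also have "\<dots> = (\<Sum>\<^bsub>K,T\<^esub> x\<otimes>y\<leftarrow>\<Delta> h. diag x (a \<boxtimes> b) \<star> diag y (c \<boxtimes> d))"
  proof (rule comult_cong[OF h])
    fix x y assume [simp, linear_intros]: "x \<in> carrier H" "y \<in> carrier H"
    have "diag x (a \<boxtimes> b) \<star> diag y (c \<boxtimes> d) =
      (\<Sum>\<^bsub>K,T\<^esub> x0\<otimes>x1\<leftarrow>\<Delta> x. \<Sum>\<^bsub>K,T\<^esub> y0\<otimes>y1\<leftarrow>\<Delta> y. actA x0 a \<boxtimes> actB x1 b \<star> actA y0 c \<boxtimes> actB y1 d)"
      by (simp add: diagonal_act_pure)
        (rule bilin_tensor_lift[OF twisted_mult_bilin], (assumption | rule linear_intros)+)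
    then show "(\<Sum>\<^bsub>K,T\<^esub> x0\<otimes>x1\<leftarrow>\<Delta> x. \<Sum>\<^bsub>K,T\<^esub> y0\<otimes>y1\<leftarrow>\<Delta> y. ?G x0 x1 y0 y1) = diag x (a \<boxtimes> b) \<star> diag y (c \<boxtimes> d)"
      by (simp add: twisted_mult_pure cong: comult_cong)
  qed
  finally show ?thesis .
qed

lemma diagonal_act_twisted_mult:
  assumes [linear_intros]: "h \<in> carrier H" and s: "s \<in> carrier T" and t [linear_intros]: "t \<in> carrier T"
  shows "diag h (s \<star> t) = (\<Sum>\<^bsub>K,T\<^esub> x\<otimes>y\<leftarrow>\<Delta> h. diag x s \<star> diag y t)"
proof (rule lin_maps_ext[OF s])
  fix a b assume [linear_intros]: "a \<in> carrier A" "b \<in> carrier B"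
  show "diag h (a \<boxtimes> b \<star> t) = (\<Sum>\<^bsub>K,T\<^esub> x\<otimes>y\<leftarrow>\<Delta> h. diag x (a \<boxtimes> b) \<star> diag y t)"
    by (rule lin_maps_ext[OF t]) (assumption | rule diagonal_act_twisted_mult_pure linear_intros)+
qed (assumption | rule linear_intros)+

theorem twisted_tensor_product_module_algebra:
  "left_hopf_module_algebra K H \<Delta> \<epsilon> S (T\<lparr>mult := (\<star>), one := \<one>\<^bsub>A\<^esub> \<boxtimes> \<one>\<^bsub>B\<^esub>\<rparr>) diag"
proof -
  interpret Tensor: left_hopf_module K H \<Delta> \<epsilon> S T diag
    by (rule diagonal_act_left_hopf_module)
  show ?thesis
    by (intro left_hopf_module_algebra.intro left_hopf_module_algebra_axioms.intro hopf_algebra_axioms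
        twisted_tensor_product_assoc_algebra)
      (simp_all add: lin_maps_record_update tensor_lift_record_update Tensor.act_one Tensor.act_mult
        bilin_maps_left[OF Tensor.act_bilin] bilin_maps_right[OF Tensor.act_bilin]
        diagonal_act_twisted_mult diagonal_act_alg_one)
qed

end

section \<open>The braiding of a Yetter--Drinfeld algebra\<close>

context yetter_drinfeld_algebra
begin

lemmas [linear_intros] = lin_maps_intros[OF coact_lin]
lemmas coact_closed [simp] = lin_maps_closed[OF coact_lin]

lemma coact_cong:
  "\<lbrakk>a \<in> carrier A; \<And>x y. \<lbrakk>x \<in> carrier A; y \<in> carrier H\<rbrakk> \<Longrightarrow> f x y = g x y\<rbrakk>
    \<Longrightarrow> tensor_lift K P f (\<rho> a) = tensor_lift K P g (\<rho> a)"
  by (rule tensor_lift_cong) (assumption | rule coact_closed linear_intros | simp)+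

lemmas coact_coassoc_lift = tensor_lift_coassoc[OF _ coact_lin comult_lin coact_coassoc]

lemma coact_mult_lift:
  assumes f: "f \<in> bilin_maps K A H P" and P [linear_intros]: "module K P"
    and [linear_intros]: "a \<in> carrier A" "b \<in> carrier A"
  shows "tensor_lift K P f (\<rho> (a \<otimes>\<^bsub>A\<^esub> b)) =
    (\<Sum>\<^bsub>K,P\<^esub> a0\<otimes>a1\<leftarrow>\<rho> a. \<Sum>\<^bsub>K,P\<^esub> b0\<otimes>b1\<leftarrow>\<rho> b. f (a0 \<otimes>\<^bsub>A\<^esub> b0) (b1 \<otimes>\<^bsub>H\<^esub> a1))"
  unfolding coact_mult[OF assms(3,4)]
  by (rule tensor_lift_lift_pure2) (assumption | rule f linear_intros)+

lemma yetter_drinfeld_lift: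
  assumes f: "f \<in> bilin_maps K A H P" and P [linear_intros]: "module K P"
    and [linear_intros]: "h \<in> carrier H" "a \<in> carrier A"
  shows "(\<Sum>\<^bsub>K,P\<^esub> h0\<otimes>h1\<leftarrow>\<Delta> h. \<Sum>\<^bsub>K,P\<^esub> x\<otimes>y\<leftarrow>\<rho> (act h1 a). f x (y \<otimes>\<^bsub>H\<^esub> h0)) =
    (\<Sum>\<^bsub>K,P\<^esub> h0\<otimes>h1\<leftarrow>\<Delta> h. \<Sum>\<^bsub>K,P\<^esub> x\<otimes>y\<leftarrow>\<rho> a. f (act h0 x) (h1 \<otimes>\<^bsub>H\<^esub> y))"
proof -
  let ?T = "tensor_mod K A H" and ?p = "pure_tensor K A H"
  have "(\<Sum>\<^bsub>K,P\<^esub> h0\<otimes>h1\<leftarrow>\<Delta> h. \<Sum>\<^bsub>K,P\<^esub> x\<otimes>y\<leftarrow>\<rho> (act h1 a). f x (y \<otimes>\<^bsub>H\<^esub> h0)) =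
      tensor_lift K P f (\<Sum>\<^bsub>K,?T\<^esub> h0\<otimes>h1\<leftarrow>\<Delta> h. \<Sum>\<^bsub>K,?T\<^esub> x\<otimes>y\<leftarrow>\<rho> (act h1 a). ?p x (y \<otimes>\<^bsub>H\<^esub> h0))"
    by (rule tensor_lift_lift_pure2[symmetric]) (assumption | rule f linear_intros)+
  also have "\<dots> =
      tensor_lift K P f (\<Sum>\<^bsub>K,?T\<^esub> h0\<otimes>h1\<leftarrow>\<Delta> h. \<Sum>\<^bsub>K,?T\<^esub> x\<otimes>y\<leftarrow>\<rho> a. ?p (act h0 x) (h1 \<otimes>\<^bsub>H\<^esub> y))"
    by (simp only: yetter_drinfeld[OF assms(3,4)])
  also have "\<dots> = (\<Sum>\<^bsub>K,P\<^esub> h0\<otimes>h1\<leftarrow>\<Delta> h. \<Sum>\<^bsub>K,P\<^esub> x\<otimes>y\<leftarrow>\<rho> a. f (act h0 x) (h1 \<otimes>\<^bsub>H\<^esub> y))"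
    by (rule tensor_lift_lift_pure2) (assumption | rule f linear_intros)+
  finally show ?thesis .
qed

end

locale yetter_drinfeld_pair = hopf_algebra K H \<Delta> \<epsilon> S +
  A: yetter_drinfeld_algebra K H \<Delta> \<epsilon> S A actA \<rho> + B: left_hopf_module_algebra K H \<Delta> \<epsilon> S B actB +
  left_hopf_module_algebra_pair K H \<Delta> \<epsilon> S A actA B actB
  for K H \<Delta> \<epsilon> S A actA \<rho> B actB
begin

definition braiding :: "'g \<Rightarrow> 'e \<Rightarrow> ('e \<times> 'g \<Rightarrow> 'a) set" where
  "braiding b c = (\<Sum>\<^bsub>K,T\<^esub> c0\<otimes>c1\<leftarrow>\<rho> c. c0 \<boxtimes> actB c1 b)"

lemma braiding_bilin: "braiding \<in> bilin_maps K B A T"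
  unfolding braiding_def by (assumption | rule linear_intros)+

lemmas [linear_intros] = bilin_maps_intros[OF braiding_bilin]
lemmas braiding_closed [simp] = bilin_maps_closed[OF braiding_bilin]

lemma braiding_one_left:
  assumes [simp, linear_intros]: "c \<in> carrier A"
  shows "braiding \<one>\<^bsub>B\<^esub> c = c \<boxtimes> \<one>\<^bsub>B\<^esub>"
proof -
  have "braiding \<one>\<^bsub>B\<^esub> c = (\<Sum>\<^bsub>K,T\<^esub> c0\<otimes>c1\<leftarrow>\<rho> c. (\<epsilon> c1 \<odot>\<^bsub>A\<^esub> c0) \<boxtimes> \<one>\<^bsub>B\<^esub>)"
    by (simp add: braiding_def B.act_alg_one pure_smult_left pure_smult_right cong: A.coact_cong)
  also have "\<dots> = (\<Sum>\<^bsub>K,A\<^esub> c0\<otimes>c1\<leftarrow>\<rho> c. \<epsilon> c1 \<odot>\<^bsub>A\<^esub> c0) \<boxtimes> \<one>\<^bsub>B\<^esub>"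
    by (rule lin_tensor_lift[of "\<lambda>x. x \<boxtimes> \<one>\<^bsub>B\<^esub>", symmetric]) (assumption | rule linear_intros)+
  also have "\<dots> = c \<boxtimes> \<one>\<^bsub>B\<^esub>"
    by (simp add: A.coact_counit)
  finally show ?thesis .
qed

lemma braiding_one_right:
  assumes [simp, linear_intros]: "b \<in> carrier B"
  shows "braiding b \<one>\<^bsub>A\<^esub> = \<one>\<^bsub>A\<^esub> \<boxtimes> b"
proof -
  have "braiding b \<one>\<^bsub>A\<^esub> = \<one>\<^bsub>A\<^esub> \<boxtimes> actB \<one>\<^bsub>H\<^esub> b"
    unfolding braiding_def A.coact_one by (rule tensor_lift_pure) (assumption | rule linear_intros)+
  then show ?thesis
    by (simp add: B.act_one)
qed

lemma braiding_mult_left: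
  assumes [simp, linear_intros]: "b \<in> carrier B" "d \<in> carrier B" "c \<in> carrier A"
  shows "braiding (b \<otimes>\<^bsub>B\<^esub> d) c = (\<Sum>\<^bsub>K,T\<^esub> u\<otimes>v\<leftarrow>braiding d c. braiding b u \<leftharpoonup> v)"
proof -
  have "braiding (b \<otimes>\<^bsub>B\<^esub> d) c =
      (\<Sum>\<^bsub>K,T\<^esub> c0\<otimes>c1\<leftarrow>\<rho> c. \<Sum>\<^bsub>K,T\<^esub> x\<otimes>y\<leftarrow>\<Delta> c1. c0 \<boxtimes> actB x b \<otimes>\<^bsub>B\<^esub> actB y d)"
    unfolding braiding_def
    by (rule A.coact_cong, simp, simp add: B.act_alg_mult, rule lin_tensor_lift)
      (assumption | rule linear_intros)+
  also have "\<dots> = (\<Sum>\<^bsub>K,T\<^esub> c0\<otimes>c1\<leftarrow>\<rho> c. \<Sum>\<^bsub>K,T\<^esub> x\<otimes>y\<leftarrow>\<rho> c0. x \<boxtimes> actB y b \<otimes>\<^bsub>B\<^esub> actB c1 d)"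
    by (rule A.coact_coassoc_lift[symmetric]) (assumption | rule linear_intros)+
  also have "\<dots> = (\<Sum>\<^bsub>K,T\<^esub> c0\<otimes>c1\<leftarrow>\<rho> c. braiding b c0 \<leftharpoonup> actB c1 d)"
  proof (rule A.coact_cong)
    fix c0 c1 assume [simp, linear_intros]: "c0 \<in> carrier A" "c1 \<in> carrier H"
    have "braiding b c0 \<leftharpoonup> actB c1 d = (\<Sum>\<^bsub>K,T\<^esub> x\<otimes>y\<leftarrow>\<rho> c0. x \<boxtimes> actB y b \<leftharpoonup> actB c1 d)"
      unfolding braiding_def
      by (rule lin_tensor_lift[of "\<lambda>t. t \<leftharpoonup> actB c1 d"]) (assumption | rule linear_intros)+
    then show "(\<Sum>\<^bsub>K,T\<^esub> x\<otimes>y\<leftarrow>\<rho> c0. x \<boxtimes> actB y b \<otimes>\<^bsub>B\<^esub> actB c1 d) = braiding b c0 \<leftharpoonup> actB c1 d"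
      by (simp cong: A.coact_cong)
  qed simp
  also have "\<dots> = (\<Sum>\<^bsub>K,T\<^esub> u\<otimes>v\<leftarrow>braiding d c. braiding b u \<leftharpoonup> v)"
    unfolding braiding_def[of d]
    by (rule tensor_lift_lift_pure[symmetric]) (assumption | rule linear_intros)+
  finally show ?thesis .
qed

lemma braiding_mult_right:
  assumes [simp, linear_intros]: "b \<in> carrier B" "c \<in> carrier A" "e \<in> carrier A"
  shows "braiding b (c \<otimes>\<^bsub>A\<^esub> e) = (\<Sum>\<^bsub>K,T\<^esub> x\<otimes>y\<leftarrow>braiding b c. x \<rightharpoonup> braiding y e)"
proof -
  have "braiding b (c \<otimes>\<^bsub>A\<^esub> e) =
      (\<Sum>\<^bsub>K,T\<^esub> c0\<otimes>c1\<leftarrow>\<rho> c. \<Sum>\<^bsub>K,T\<^esub> e0\<otimes>e1\<leftarrow>\<rho> e. c0 \<otimes>\<^bsub>A\<^esub> e0 \<boxtimes> actB (e1 \<otimes>\<^bsub>H\<^esub> c1) b)"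
    unfolding braiding_def by (rule A.coact_mult_lift) (assumption | rule linear_intros)+
  also have "\<dots> = (\<Sum>\<^bsub>K,T\<^esub> c0\<otimes>c1\<leftarrow>\<rho> c. c0 \<rightharpoonup> braiding (actB c1 b) e)"
  proof (rule A.coact_cong)
    fix c0 c1 assume [simp, linear_intros]: "c0 \<in> carrier A" "c1 \<in> carrier H"
    have "c0 \<rightharpoonup> braiding (actB c1 b) e = (\<Sum>\<^bsub>K,T\<^esub> e0\<otimes>e1\<leftarrow>\<rho> e. c0 \<rightharpoonup> e0 \<boxtimes> actB e1 (actB c1 b))"
      unfolding braiding_def by (rule lin_tensor_lift) (assumption | rule linear_intros)+
    then show "(\<Sum>\<^bsub>K,T\<^esub> e0\<otimes>e1\<leftarrow>\<rho> e. c0 \<otimes>\<^bsub>A\<^esub> e0 \<boxtimes> actB (e1 \<otimes>\<^bsub>H\<^esub> c1) b) = c0 \<rightharpoonup> braiding (actB c1 b) e"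
      by (simp add: B.act_mult cong: A.coact_cong)
  qed simp
  also have "\<dots> = (\<Sum>\<^bsub>K,T\<^esub> x\<otimes>y\<leftarrow>braiding b c. x \<rightharpoonup> braiding y e)"
    unfolding braiding_def[of b c]
    by (rule tensor_lift_lift_pure[symmetric]) (assumption | rule linear_intros)+
  finally show ?thesis .
qed

lemma braiding_equivariant:
  assumes [simp, linear_intros]: "h \<in> carrier H" "b \<in> carrier B" "c \<in> carrier A"
  shows "diag h (braiding b c) = (\<Sum>\<^bsub>K,T\<^esub> x\<otimes>y\<leftarrow>\<Delta> h. braiding (actB x b) (actA y c))"
proof -
  have "diag h (braiding b c) = (\<Sum>\<^bsub>K,T\<^esub> c0\<otimes>c1\<leftarrow>\<rho> c. diag h (c0 \<boxtimes> actB c1 b))"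
    unfolding braiding_def by (rule lin_tensor_lift) (assumption | rule linear_intros)+
  also have "\<dots> = (\<Sum>\<^bsub>K,T\<^esub> c0\<otimes>c1\<leftarrow>\<rho> c. \<Sum>\<^bsub>K,T\<^esub> x\<otimes>y\<leftarrow>\<Delta> h. actA x c0 \<boxtimes> actB (y \<otimes>\<^bsub>H\<^esub> c1) b)"
    by (rule A.coact_cong) (simp_all add: diagonal_act_pure B.act_mult cong: comult_cong)
  also have "\<dots> = (\<Sum>\<^bsub>K,T\<^esub> x\<otimes>y\<leftarrow>\<Delta> h. \<Sum>\<^bsub>K,T\<^esub> c0\<otimes>c1\<leftarrow>\<rho> c. actA x c0 \<boxtimes> actB (y \<otimes>\<^bsub>H\<^esub> c1) b)"
    by (rule tensor_lift_swap) (assumption | rule linear_intros)+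
  also have "\<dots> = (\<Sum>\<^bsub>K,T\<^esub> x\<otimes>y\<leftarrow>\<Delta> h. \<Sum>\<^bsub>K,T\<^esub> c0\<otimes>c1\<leftarrow>\<rho> (actA y c). c0 \<boxtimes> actB (c1 \<otimes>\<^bsub>H\<^esub> x) b)"
    by (rule A.yetter_drinfeld_lift[symmetric]) (assumption | rule linear_intros)+
  also have "\<dots> = (\<Sum>\<^bsub>K,T\<^esub> x\<otimes>y\<leftarrow>\<Delta> h. braiding (actB x b) (actA y c))"
    by (rule comult_cong) (simp_all add: braiding_def B.act_mult cong: A.coact_cong)
  finally show ?thesis .
qed

abbreviation "R \<equiv> braided_tensor_alg K A \<rho> B actB"

lemma braided_mult_bilin: "mult R \<in> bilin_maps K T T T"
  unfolding braided_tensor_alg_def Let_def by simp (assumption | rule linear_intros)+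

lemma braided_mult_pure:
  assumes [simp, linear_intros]: "a \<in> carrier A" "b \<in> carrier B" "c \<in> carrier A" "d \<in> carrier B"
  shows "(a \<boxtimes> b) \<otimes>\<^bsub>R\<^esub> (c \<boxtimes> d) = (\<Sum>\<^bsub>K,T\<^esub> c0\<otimes>c1\<leftarrow>\<rho> c. a \<otimes>\<^bsub>A\<^esub> c0 \<boxtimes> actB c1 b \<otimes>\<^bsub>B\<^esub> d)"
proof -
  have "(a \<boxtimes> b) \<otimes>\<^bsub>R\<^esub> (c \<boxtimes> d) = (\<Sum>\<^bsub>K,T\<^esub> c\<otimes>d\<leftarrow>c \<boxtimes> d. \<Sum>\<^bsub>K,T\<^esub> c0\<otimes>c1\<leftarrow>\<rho> c. a \<otimes>\<^bsub>A\<^esub> c0 \<boxtimes> actB c1 b \<otimes>\<^bsub>B\<^esub> d)"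
    unfolding braided_tensor_alg_def Let_def
    by simp (rule tensor_lift_pure, (assumption | rule linear_intros)+)
  also have "\<dots> = (\<Sum>\<^bsub>K,T\<^esub> c0\<otimes>c1\<leftarrow>\<rho> c. a \<otimes>\<^bsub>A\<^esub> c0 \<boxtimes> actB c1 b \<otimes>\<^bsub>B\<^esub> d)"
    by (rule tensor_lift_pure) (assumption | rule linear_intros)+
  finally show ?thesis .
qed

lemma braided_mult_braiding:
  assumes [simp, linear_intros]: "a \<in> carrier A" "b \<in> carrier B" "c \<in> carrier A" "d \<in> carrier B"
  shows "(a \<boxtimes> b) \<otimes>\<^bsub>R\<^esub> (c \<boxtimes> d) = a \<rightharpoonup> braiding b c \<leftharpoonup> d"
proof -
  have "a \<rightharpoonup> braiding b c \<leftharpoonup> d = (\<Sum>\<^bsub>K,T\<^esub> c0\<otimes>c1\<leftarrow>\<rho> c. a \<rightharpoonup> c0 \<boxtimes> actB c1 b \<leftharpoonup> d)"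
    unfolding braiding_def
    by (rule lin_tensor_lift[of "\<lambda>t. a \<rightharpoonup> t \<leftharpoonup> d"]) (assumption | rule linear_intros)+
  then show ?thesis
    by (simp add: braided_mult_pure cong: A.coact_cong)
qed

sublocale equivariant_twisted_tensor_product K H \<Delta> \<epsilon> S A actA B actB braiding "mult R"
  by unfold_locales
    (simp_all add: braiding_bilin braiding_one_left braiding_one_right braiding_mult_left
      braiding_mult_right braiding_equivariant braided_mult_bilin braided_mult_braiding)

lemma braided_tensor_alg_module_algebra: "left_hopf_module_algebra K H \<Delta> \<epsilon> S R diag"
proof -
  have "R = T\<lparr>mult := mult R, one := \<one>\<^bsub>A\<^esub> \<boxtimes> \<one>\<^bsub>B\<^esub>\<rparr>"
    by (simp add: braided_tensor_alg_def Let_def)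
  then show ?thesis
    using twisted_tensor_product_module_algebra by simp
qed

end

theorem lemma5p1:
  fixes K :: "('k, 'x) ring_scheme"
    and H :: "('k, 'h, 'y) module_scheme"
    and A :: "('k, 'a, 'z) module_scheme"
    and B :: "('k, 'b, 'w) module_scheme"
    and \<Delta> :: "'h \<Rightarrow> ('h \<times> 'h \<Rightarrow> 'k) set"
    and \<epsilon> :: "'h \<Rightarrow> 'k"
    and S :: "'h \<Rightarrow> 'h"
    and actA :: "'h \<Rightarrow> 'a \<Rightarrow> 'a"
    and \<rho> :: "'a \<Rightarrow> ('a \<times> 'h \<Rightarrow> 'k) set"
    and actB :: "'h \<Rightarrow> 'b \<Rightarrow> 'b"
  assumes "field K"
    and "\<And>n::nat. n > 0 \<Longrightarrow> [n] \<cdot>\<^bsub>K\<^esub> \<one>\<^bsub>K\<^esub> \<noteq> \<zero>\<^bsub>K\<^esub>"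
    and "hopf_algebra K H \<Delta> \<epsilon> S"
    and "bij_betw S (carrier H) (carrier H)"
    and "left_hopf_module_algebra K H \<Delta> \<epsilon> S B actB"
    and "yetter_drinfeld_algebra K H \<Delta> \<epsilon> S A actA \<rho>"
  shows "left_hopf_module_algebra K H \<Delta> \<epsilon> S
           (braided_tensor_alg K A \<rho> B actB) (diagonal_act K \<Delta> A actA B actB) \<and>
         (\<forall>a\<in>carrier A. \<forall>b\<in>carrier B. \<forall>c\<in>carrier A. \<forall>d\<in>carrier B.
           pure_tensor K A B a b \<otimes>\<^bsub>braided_tensor_alg K A \<rho> B actB\<^esub> pure_tensor K A B c d =
           tensor_lift K (tensor_mod K A B)
             (\<lambda>c0 c1. pure_tensor K A B (a \<otimes>\<^bsub>A\<^esub> c0) (actB c1 b \<otimes>\<^bsub>B\<^esub> d)) (\<rho> c)) \<and>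
         (\<forall>h\<in>carrier H. \<forall>a\<in>carrier A. \<forall>b\<in>carrier B.
           diagonal_act K \<Delta> A actA B actB h (pure_tensor K A B a b) =
           tensor_lift K (tensor_mod K A B)
             (\<lambda>h0 h1. pure_tensor K A B (actA h0 a) (actB h1 b)) (\<Delta> h))"
proof -
  interpret left_hopf_module_algebra K H \<Delta> \<epsilon> S B actB by (rule assms(5))
  interpret A: yetter_drinfeld_algebra K H \<Delta> \<epsilon> S A actA \<rho> by (rule assms(6))
  interpret yetter_drinfeld_pair K H \<Delta> \<epsilon> S A actA \<rho> B actB ..
  show ?thesis
    using braided_tensor_alg_module_algebra by (simp add: braided_mult_pure diagonal_act_pure)
qed

end
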